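(* There exist non-empty sets $S_q\subseteq\mathbb{Z}_{>0}$, for $q\in\{2,3,4,5,7,11,13,17,19\}$, such that the $3$-dimensional Fine $\mathbb{Q}$-codegree spectrum is $$S^F(3)=\left\{\frac{q}{k\cdot\ell}\;\middle|\; q\in\{2,3,4,5,7,11,13,17,19\},\ \ell\in S_q,\ k\in\mathbb{Z}_{>0}\right\}.$$
   Context: For a $d$-dimensional rational polytope $P\subseteq\mathbb{R}^d$ and $a\in(\mathbb{Z}^d)^*$ let $h_P(a)=\min_{x\in P}\langle a,x\rangle$. For $s>0$ the Fine adjoint polytope is $P^{F(s)}=\{x\in\mathbb{R}^d : \langle a,x\rangle\ge h_P(a)+s \text{ for all } a\in(\mathbb{Z}^d)^*\setminus\{0\}\}$. The Fine $\mathbb{Q}$-codegree is $\mu^F(P)=(\sup\{s>0 : P^{F(s)}\neq\emptyset\})^{-1}$. The Fine spectrum in dimension $d$ is $S^F(d)=\{\mu^F(P) : P \text{ a } d\text{-dimensional lattice polytope}\}$, lattice polytopes being those with vertices in $\mathbb{Z}^d$. *)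

theory Defs
  imports "HOL-Analysis.Analysis"
begin

text \<open>Integer points of R^3; the dual lattice is identified with integer vectors via the inner product.\<close>
definition int_vec :: "real^3 \<Rightarrow> bool" where
  "int_vec v \<longleftrightarrow> (\<forall>i. v $ i \<in> \<int>)"

definition lattice_polytope3 :: "(real^3) set \<Rightarrow> bool" where
  "lattice_polytope3 P \<longleftrightarrow>
     (\<exists>V. finite V \<and> V \<noteq> {} \<and> (\<forall>v\<in>V. int_vec v) \<and> P = convex hull V) \<and> aff_dim P = 3"

definition hP :: "(real^3) set \<Rightarrow> real^3 \<Rightarrow> real" where
  "hP P a = Inf ((\<lambda>x. a \<bullet> x) ` P)"

definition fine_adjoint :: "(real^3) set \<Rightarrow> real \<Rightarrow> (real^3) set" where
  "fine_adjoint P s = {x. \<forall>a. int_vec a \<and> a \<noteq> 0 \<longrightarrow> a \<bullet> x \<ge> hP P a + s}"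

definition fine_codegree :: "(real^3) set \<Rightarrow> real" where
  "fine_codegree P = inverse (Sup {s. s > 0 \<and> fine_adjoint P s \<noteq> {}})"

definition fine_spectrum3 :: "real set" where
  "fine_spectrum3 = {fine_codegree P | P. lattice_polytope3 P}"

end

(* Let s be the largest number for which the adjoint polytope is non-empty, x a point of it, and A the
   set of lattice vectors a whose inequality is tight at x. By maximality 0 lies in the convex hull of
   A, and every non-zero lattice point of that hull belongs to A because the support function is
   concave. Among the subsets T of A with 0 in their convex hull take one minimising the number of
   points of A in the hull plus the cardinality of T: it is the vertex set of a simplex whose only
   lattice points are its vertices and 0. If u are the barycentric coordinates of 0 in T, then
   s = - sum u_t h_P(t) with integers h_P(t), so q s is an integer whenever q u is integral.
   The possible least q are found as follows. The point with barycentric coordinates frac (k u) is a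
   lattice point if they sum to 1, hence their sum is 2 for a tetrahedron unless one of k - 1, k,
   k + 1 is a period of u. Imposing this for k = 2, ..., 18 is contradictory, so the least period is
   at most 19, and a finite check leaves the list of the theorem.
   Finally, dilating P divides the codegree, so the numerator may also be artificially enlarged. *)
theory Submission
  imports Defs
begin

section \<open>Weights of terminal simplices\<close>

text \<open>The hypothesis says that the floors of k a, k b, k c, k d sum to k - 2 and that none of these
  numbers is an integer. It is exploited as a search tree: each k pins the floors down to very few
  possibilities, which shrinks the box containing (a, b, c, d) until it is empty.\<close>
lemma balanced_reals_contradiction:
  fixes a b c d :: real
  assumes ord: "0 < a" "a \<le> b" "b \<le> c" "c \<le> d" "a + b + c + d = 1"
    and H: "\<And>k. k \<in> {2..18::int} \<Longrightarrow> \<exists>p q r s::int. p + q + r + s = k - 2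
      \<and> p < k * a \<and> k * a < p + 1 \<and> q < k * b \<and> k * b < q + 1
      \<and> r < k * c \<and> k * c < r + 1 \<and> s < k * d \<and> k * d < real_of_int s + 1"
  shows False
proof -
  \<comment> \<open>The order of a, b, c, d passes to the floors of their multiples by k. Together
    with the prescribed sum k - 2 this leaves few quadruples p, q, r, s; each use of
    \<open>N\<close> below evaluates one k.\<close>
  have N: thesis if k_in: "k \<in> {2..18}"
    and *: "\<And>p q r s::int. \<lbrakk>p + q + r + s = k - 2; 0 \<le> p; p \<le> q; q \<le> r; r \<le> s;
      p < k * a; k * a < real_of_int p + 1; q < k * b; k * b < real_of_int q + 1; r < k * c; k * c < real_of_int r + 1;
      s < k * d; k * d < real_of_int s + 1\<rbrakk> \<Longrightarrow> thesis" for k :: int and thesis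
  proof -
    obtain p q r s :: int where F: "p + q + r + s = k - 2" "p < k * a" "k * a < real_of_int p + 1"
      "q < k * b" "k * b < real_of_int q + 1" "r < k * c" "k * c < real_of_int r + 1" "s < k * d" "k * d < real_of_int s + 1"
      using H[OF k_in] by auto
    have k: "0 < real_of_int k" using k_in by simp
    then have "0 < k * a" "k * a \<le> k * b" "k * b \<le> k * c" "k * c \<le> k * d"
      using ord by simp_all
    then have le: "0 \<le> p" "p \<le> q" "q \<le> r" "r \<le> s"
      using F by linarith+
    show thesis by (rule *[OF F(1) le F(2-)])
  qed
  have "d < 1/2"
  proof -
    obtain p q r s :: int where *: "p + q + r + s = 0" "0 \<le> p" "p \<le> q" "q \<le> r" "r \<le> s"
      "p < 2 * a" "2 * a < real_of_int p + 1" "q < 2 * b" "2 * b < real_of_int q + 1"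
      "r < 2 * c" "2 * c < real_of_int r + 1" "s < 2 * d" "2 * d < real_of_int s + 1"
      by (rule N[of 2]) auto
    have i: "s \<le> 0" using *(1-5) by linarith+
    show "d < 1/2" using *(6-) i by linarith+
  qed
  \<comment> \<open>From here on each k is chosen so that the bounds already found fix most of its
    floors; the sum k - 2 settles the rest and yields new bounds at multiples of 1/k.\<close>
  have "c < 1/3" "1/3 < d"
  proof -
    obtain p q r s :: int where *: "p + q + r + s = 1" "0 \<le> p" "p \<le> q" "q \<le> r" "r \<le> s"
      "p < 3 * a" "3 * a < real_of_int p + 1" "q < 3 * b" "3 * b < real_of_int q + 1"
      "r < 3 * c" "3 * c < real_of_int r + 1" "s < 3 * d" "3 * d < real_of_int s + 1"
      by (rule N[of 3]) auto
    have s: "s \<le> 1" using *(12,13) \<open>d < 1/2\<close> by linarith+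
    have i: "r \<le> 0" "1 \<le> s" using *(1-5) s by linarith+
    show "c < 1/3" "1/3 < d" using *(6-) i by linarith+
  qed
  have "b < 1/4" "1/4 < c"
  proof -
    obtain p q r s :: int where *: "p + q + r + s = 2" "0 \<le> p" "p \<le> q" "q \<le> r" "r \<le> s"
      "p < 4 * a" "4 * a < real_of_int p + 1" "q < 4 * b" "4 * b < real_of_int q + 1"
      "r < 4 * c" "4 * c < real_of_int r + 1" "s < 4 * d" "4 * d < real_of_int s + 1"
      by (rule N[of 4]) auto
    have s: "s \<le> 1" using *(12,13) \<open>1/3 < d\<close> \<open>d < 1/2\<close> by linarith+
    have i: "q \<le> 0" "1 \<le> r" using *(1-5) s by linarith+
    show "b < 1/4" "1/4 < c" using *(6-) i by linarith+
  qed
  have "a < 1/6" "1/6 < b"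
  proof -
    obtain p q r s :: int where *: "p + q + r + s = 4" "0 \<le> p" "p \<le> q" "q \<le> r" "r \<le> s"
      "p < 6 * a" "6 * a < real_of_int p + 1" "q < 6 * b" "6 * b < real_of_int q + 1"
      "r < 6 * c" "6 * c < real_of_int r + 1" "s < 6 * d" "6 * d < real_of_int s + 1"
      by (rule N[of 6]) auto
    have s: "s = 2" using *(12,13) \<open>1/3 < d\<close> \<open>d < 1/2\<close> by linarith+
    have r: "r = 1" using *(10,11) \<open>1/4 < c\<close> \<open>c < 1/3\<close> by linarith+
    have q: "q \<le> 1" using *(8,9) \<open>b < 1/4\<close> by linarith+
    have i: "p = 0" "q = 1" using *(1-5) s r q by linarith+
    show "a < 1/6" "1/6 < b" using *(6-) i by linarith+
  qed
  \<comment> \<open>First fork: for k = 12 the box forces q = 2 and r = 3, so p + s = 5 with s equal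
    to 4 or 5.\<close>
  consider "5/12 < d" "a < 1/12" | "d < 5/12" "1/12 < a"
  proof -
    obtain p q r s :: int where *: "p + q + r + s = 10" "0 \<le> p" "p \<le> q" "q \<le> r" "r \<le> s"
      "p < 12 * a" "12 * a < real_of_int p + 1" "q < 12 * b" "12 * b < real_of_int q + 1"
      "r < 12 * c" "12 * c < real_of_int r + 1" "s < 12 * d" "12 * d < real_of_int s + 1"
      by (rule N[of 12]) auto
    have r: "r = 3" using *(10,11) \<open>1/4 < c\<close> \<open>c < 1/3\<close> by linarith+
    have q: "q = 2" using *(8,9) \<open>1/6 < b\<close> \<open>b < 1/4\<close> by linarith+
    have s: "4 \<le> s" "s \<le> 5" using *(12,13) \<open>1/3 < d\<close> \<open>d < 1/2\<close> by linarith+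
    have p: "p \<le> 1" using *(6,7) \<open>0 < a\<close> \<open>a < 1/6\<close> by linarith+
    show thesis
    proof (cases "4 < s")
      case True
      have i: "s = 5" "p = 0" using *(1-5) r q s p True by linarith+
      have "5/12 < d" "a < 1/12" using *(6-) i by linarith+
      then show thesis by (rule that(1))
    next
      case False
      have i: "s = 4" "p = 1" using *(1-5) r q s p False by linarith+
      have "d < 5/12" "1/12 < a" using *(6-) i by linarith+
      then show thesis by (rule that(2))
    qed
  qed
  then show False
  proof cases
    case 1
    have "b < 1/5"
    proof -
      obtain p q r s :: int where *: "p + q + r + s = 3" "0 \<le> p" "p \<le> q" "q \<le> r" "r \<le> s"
        "p < 5 * a" "5 * a < real_of_int p + 1" "q < 5 * b" "5 * b < real_of_int q + 1"
        "r < 5 * c" "5 * c < real_of_int r + 1" "s < 5 * d" "5 * d < real_of_int s + 1"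
        by (rule N[of 5]) auto
      have s: "s = 2" using *(12,13) \<open>5/12 < d\<close> \<open>d < 1/2\<close> by linarith+
      have r: "r = 1" using *(10,11) \<open>1/4 < c\<close> \<open>c < 1/3\<close> by linarith+
      have i: "q = 0" using *(1-5) s r by linarith+
      show "b < 1/5" using *(6-) i by linarith+
    qed
    consider "c < 2/7" "3/7 < d" | "2/7 < c" "d < 3/7"
    proof -
      obtain p q r s :: int where *: "p + q + r + s = 5" "0 \<le> p" "p \<le> q" "q \<le> r" "r \<le> s"
        "p < 7 * a" "7 * a < real_of_int p + 1" "q < 7 * b" "7 * b < real_of_int q + 1"
        "r < 7 * c" "7 * c < real_of_int r + 1" "s < 7 * d" "7 * d < real_of_int s + 1"
        by (rule N[of 7]) auto
      have q: "q = 1" using *(8,9) \<open>1/6 < b\<close> \<open>b < 1/5\<close> by linarith+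
      have p: "p = 0" using *(6,7) \<open>0 < a\<close> \<open>a < 1/12\<close> by linarith+
      have s: "2 \<le> s" "s \<le> 3" using *(12,13) \<open>5/12 < d\<close> \<open>d < 1/2\<close> by linarith+
      show thesis
      proof (cases "2 < s")
        case True
        have i: "s = 3" "r = 1" using *(1-5) q p s True by linarith+
        have "c < 2/7" "3/7 < d" using *(6-) i by linarith+
        then show thesis by (rule that(1))
      next
        case False
        have i: "s = 2" "r = 2" using *(1-5) q p s False by linarith+
        have "2/7 < c" "d < 3/7" using *(6-) i by linarith+
        then show thesis by (rule that(2))
      qed
    qed
    then show False
    proof cases
      case 1
      \<comment> \<open>A leaf: for k = 10 the box fixes the floors as 0, 1, 2, 4, whose sum is 7
        and not 8. The other leaves close in the same way.\<close>
      obtain p q r s :: int where *: "p + q + r + s = 8" "0 \<le> p" "p \<le> q" "q \<le> r" "r \<le> s"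
        "p < 10 * a" "10 * a < real_of_int p + 1" "q < 10 * b" "10 * b < real_of_int q + 1"
        "r < 10 * c" "10 * c < real_of_int r + 1" "s < 10 * d" "10 * d < real_of_int s + 1"
        by (rule N[of 10]) auto
      have s: "s = 4" using *(12,13) \<open>3/7 < d\<close> \<open>d < 1/2\<close> by linarith+
      have r: "r = 2" using *(10,11) \<open>1/4 < c\<close> \<open>c < 2/7\<close> by linarith+
      have q: "q = 1" using *(8,9) \<open>1/6 < b\<close> \<open>b < 1/5\<close> by linarith+
      have p: "p = 0" using *(6,7) \<open>0 < a\<close> \<open>a < 1/12\<close> by linarith+
      show False using *(1-5) s r q p by linarith
    next
      case 2
      obtain p q r s :: int where *: "p + q + r + s = 7" "0 \<le> p" "p \<le> q" "q \<le> r" "r \<le> s"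
        "p < 9 * a" "9 * a < real_of_int p + 1" "q < 9 * b" "9 * b < real_of_int q + 1"
        "r < 9 * c" "9 * c < real_of_int r + 1" "s < 9 * d" "9 * d < real_of_int s + 1"
        by (rule N[of 9]) auto
      have s: "s = 3" using *(12,13) \<open>5/12 < d\<close> \<open>d < 3/7\<close> by linarith+
      have r: "r = 2" using *(10,11) \<open>2/7 < c\<close> \<open>c < 1/3\<close> by linarith+
      have q: "q = 1" using *(8,9) \<open>1/6 < b\<close> \<open>b < 1/5\<close> by linarith+
      have p: "p = 0" using *(6,7) \<open>0 < a\<close> \<open>a < 1/12\<close> by linarith+
      show False using *(1-5) s r q p by linarith
    qed
  next
    case 2
    \<comment> \<open>For k = 9 the box forces r = 2 and s = 3, so p + q = 2, and (p, q) is (0, 2)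
      or (1, 1).\<close>
    consider "a < 1/9" "2/9 < b" | "1/9 < a" "b < 2/9"
    proof -
      obtain p q r s :: int where *: "p + q + r + s = 7" "0 \<le> p" "p \<le> q" "q \<le> r" "r \<le> s"
        "p < 9 * a" "9 * a < real_of_int p + 1" "q < 9 * b" "9 * b < real_of_int q + 1"
        "r < 9 * c" "9 * c < real_of_int r + 1" "s < 9 * d" "9 * d < real_of_int s + 1"
        by (rule N[of 9]) auto
      have s: "s = 3" using *(12,13) \<open>1/3 < d\<close> \<open>d < 5/12\<close> by linarith+
      have r: "r = 2" using *(10,11) \<open>1/4 < c\<close> \<open>c < 1/3\<close> by linarith+
      have q: "1 \<le> q" "q \<le> 2" using *(8,9) \<open>1/6 < b\<close> \<open>b < 1/4\<close> by linarith+
      have p: "p \<le> 1" using *(6,7) \<open>1/12 < a\<close> \<open>a < 1/6\<close> by linarith+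
      show thesis
      proof (cases "1 < q")
        case True
        have i: "q = 2" "p = 0" using *(1-5) s r q p True by linarith+
        have "a < 1/9" "2/9 < b" using *(6-) i by linarith+
        then show thesis by (rule that(1))
      next
        case False
        have i: "q = 1" "p = 1" using *(1-5) s r q p False by linarith+
        have "1/9 < a" "b < 2/9" using *(6-) i by linarith+
        then show thesis by (rule that(2))
      qed
    qed
    then show False
    proof cases
      case 1
      have "2/7 < c"
      proof -
        obtain p q r s :: int where *: "p + q + r + s = 5" "0 \<le> p" "p \<le> q" "q \<le> r" "r \<le> s"
          "p < 7 * a" "7 * a < real_of_int p + 1" "q < 7 * b" "7 * b < real_of_int q + 1"
          "r < 7 * c" "7 * c < real_of_int r + 1" "s < 7 * d" "7 * d < real_of_int s + 1"
          by (rule N[of 7]) auto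
        have s: "s = 2" using *(12,13) \<open>1/3 < d\<close> \<open>d < 5/12\<close> by linarith+
        have q: "q = 1" using *(8,9) \<open>2/9 < b\<close> \<open>b < 1/4\<close> by linarith+
        have p: "p = 0" using *(6,7) \<open>1/12 < a\<close> \<open>a < 1/9\<close> by linarith+
        have i: "r = 2" using *(1-5) s q p by linarith+
        show "2/7 < c" using *(6-) i by linarith+
      qed
      have "3/8 < d"
      proof -
        obtain p q r s :: int where *: "p + q + r + s = 6" "0 \<le> p" "p \<le> q" "q \<le> r" "r \<le> s"
          "p < 8 * a" "8 * a < real_of_int p + 1" "q < 8 * b" "8 * b < real_of_int q + 1"
          "r < 8 * c" "8 * c < real_of_int r + 1" "s < 8 * d" "8 * d < real_of_int s + 1"
          by (rule N[of 8]) auto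
        have r: "r = 2" using *(10,11) \<open>2/7 < c\<close> \<open>c < 1/3\<close> by linarith+
        have q: "q = 1" using *(8,9) \<open>2/9 < b\<close> \<open>b < 1/4\<close> by linarith+
        have p: "p = 0" using *(6,7) \<open>1/12 < a\<close> \<open>a < 1/9\<close> by linarith+
        have i: "s = 3" using *(1-5) r q p by linarith+
        show "3/8 < d" using *(6-) i by linarith+
      qed
      obtain p q r s :: int where *: "p + q + r + s = 12" "0 \<le> p" "p \<le> q" "q \<le> r" "r \<le> s"
        "p < 14 * a" "14 * a < real_of_int p + 1" "q < 14 * b" "14 * b < real_of_int q + 1"
        "r < 14 * c" "14 * c < real_of_int r + 1" "s < 14 * d" "14 * d < real_of_int s + 1"
        by (rule N[of 14]) auto
      have p: "p = 1" using *(6,7) \<open>1/12 < a\<close> \<open>a < 1/9\<close> by linarith+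
      have q: "q = 3" using *(8,9) \<open>2/9 < b\<close> \<open>b < 1/4\<close> by linarith+
      have r: "r = 4" using *(10,11) \<open>2/7 < c\<close> \<open>c < 1/3\<close> by linarith+
      have s: "s = 5" using *(12,13) \<open>3/8 < d\<close> \<open>d < 5/12\<close> by linarith+
      show False using *(1-5) p q r s by linarith
    next
      case 2
      consider "c < 5/18" "7/18 < d" | "5/18 < c" "d < 7/18"
      proof -
        obtain p q r s :: int where *: "p + q + r + s = 16" "0 \<le> p" "p \<le> q" "q \<le> r" "r \<le> s"
          "p < 18 * a" "18 * a < real_of_int p + 1" "q < 18 * b" "18 * b < real_of_int q + 1"
          "r < 18 * c" "18 * c < real_of_int r + 1" "s < 18 * d" "18 * d < real_of_int s + 1"
          by (rule N[of 18]) auto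
        have p: "p = 2" using *(6,7) \<open>1/9 < a\<close> \<open>a < 1/6\<close> by linarith+
        have q: "q = 3" using *(8,9) \<open>1/6 < b\<close> \<open>b < 2/9\<close> by linarith+
        have s: "6 \<le> s" "s \<le> 7" using *(12,13) \<open>1/3 < d\<close> \<open>d < 5/12\<close> by linarith+
        have r: "r \<le> 5" "4 \<le> r" using *(10,11) \<open>1/4 < c\<close> \<open>c < 1/3\<close> by linarith+
        show thesis
        proof (cases "r \<le> 4")
          case True
          have i: "r = 4" "s = 7" using *(1-5) p q s r True by linarith+
          have "c < 5/18" "7/18 < d" using *(6-) i by linarith+
          then show thesis by (rule that(1))
        next
          case False
          have i: "r = 5" "s = 6" using *(1-5) p q s r False by linarith+
          have "5/18 < c" "d < 7/18" using *(6-) i by linarith+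
          then show thesis by (rule that(2))
        qed
      qed
      then show False
      proof cases
        case 1
        have "1/7 < a"
        proof -
          obtain p q r s :: int where *: "p + q + r + s = 5" "0 \<le> p" "p \<le> q" "q \<le> r" "r \<le> s"
            "p < 7 * a" "7 * a < real_of_int p + 1" "q < 7 * b" "7 * b < real_of_int q + 1"
            "r < 7 * c" "7 * c < real_of_int r + 1" "s < 7 * d" "7 * d < real_of_int s + 1"
            by (rule N[of 7]) auto
          have s: "s = 2" using *(12,13) \<open>7/18 < d\<close> \<open>d < 5/12\<close> by linarith+
          have r: "r = 1" using *(10,11) \<open>1/4 < c\<close> \<open>c < 5/18\<close> by linarith+
          have q: "q = 1" using *(8,9) \<open>1/6 < b\<close> \<open>b < 2/9\<close> by linarith+
          have i: "p = 1" using *(1-5) s r q by linarith+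
          show "1/7 < a" using *(6-) i by linarith+
        qed
        obtain p q r s :: int where *: "p + q + r + s = 6" "0 \<le> p" "p \<le> q" "q \<le> r" "r \<le> s"
          "p < 8 * a" "8 * a < real_of_int p + 1" "q < 8 * b" "8 * b < real_of_int q + 1"
          "r < 8 * c" "8 * c < real_of_int r + 1" "s < 8 * d" "8 * d < real_of_int s + 1"
          by (rule N[of 8]) auto
        have p: "p = 1" using *(6,7) \<open>1/7 < a\<close> \<open>a < 1/6\<close> by linarith+
        have q: "q = 1" using *(8,9) \<open>1/6 < b\<close> \<open>b < 2/9\<close> by linarith+
        have r: "r = 2" using *(10,11) \<open>1/4 < c\<close> \<open>c < 5/18\<close> by linarith+
        have s: "s = 3" using *(12,13) \<open>7/18 < d\<close> \<open>d < 5/12\<close> by linarith+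
        show False using *(1-5) p q r s by linarith
      next
        case 2
        have "1/5 < b"
        proof -
          obtain p q r s :: int where *: "p + q + r + s = 3" "0 \<le> p" "p \<le> q" "q \<le> r" "r \<le> s"
            "p < 5 * a" "5 * a < real_of_int p + 1" "q < 5 * b" "5 * b < real_of_int q + 1"
            "r < 5 * c" "5 * c < real_of_int r + 1" "s < 5 * d" "5 * d < real_of_int s + 1"
            by (rule N[of 5]) auto
          have s: "s = 1" using *(12,13) \<open>1/3 < d\<close> \<open>d < 7/18\<close> by linarith+
          have r: "r = 1" using *(10,11) \<open>5/18 < c\<close> \<open>c < 1/3\<close> by linarith+
          have p: "p = 0" using *(6,7) \<open>1/9 < a\<close> \<open>a < 1/6\<close> by linarith+
          have i: "q = 1" using *(1-5) s r p by linarith+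
          show "1/5 < b" using *(6-) i by linarith+
        qed
        \<comment> \<open>For k = 13 one has q = 2 and p + r + s = 9. Each of p, r, s has two
          consecutive possible values, and the smaller ones sum to 8, so exactly one of the three
          takes its larger value.\<close>
        consider "a < 2/13" "c < 4/13" "5/13 < d" | "a < 2/13" "4/13 < c" "d < 5/13" | "2/13 < a" "c < 4/13" "d < 5/13"
        proof -
          obtain p q r s :: int where *: "p + q + r + s = 11" "0 \<le> p" "p \<le> q" "q \<le> r" "r \<le> s"
            "p < 13 * a" "13 * a < real_of_int p + 1" "q < 13 * b" "13 * b < real_of_int q + 1"
            "r < 13 * c" "13 * c < real_of_int r + 1" "s < 13 * d" "13 * d < real_of_int s + 1"
            by (rule N[of 13]) auto
          have q: "q = 2" using *(8,9) \<open>1/5 < b\<close> \<open>b < 2/9\<close> by linarith+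
          have r: "3 \<le> r" "r \<le> 4" using *(10,11) \<open>5/18 < c\<close> \<open>c < 1/3\<close> by linarith+
          have s: "4 \<le> s" "s \<le> 5" using *(12,13) \<open>1/3 < d\<close> \<open>d < 7/18\<close> by linarith+
          have p: "1 \<le> p" "p \<le> 2" using *(6,7) \<open>1/9 < a\<close> \<open>a < 1/6\<close> by linarith+
          show thesis
          proof (cases "4 < s")
            case True
            have i: "s = 5" "r = 3" "p = 1" using *(1-5) q r s p True by linarith+
            have "a < 2/13" "c < 4/13" "5/13 < d" using *(6-) i by linarith+
            then show thesis by (rule that(1))
          next
            case False
            note n = False
            show thesis
            proof (cases "3 < r")
              case True
              have i: "s = 4" "r = 4" "p = 1" using *(1-5) q r s p n True by linarith+
              have "a < 2/13" "4/13 < c" "d < 5/13" using *(6-) i by linarith+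
              then show thesis by (rule that(2))
            next
              case False
              have i: "s = 4" "r = 3" "p = 2" using *(1-5) q r s p n False by linarith+
              have "2/13 < a" "c < 4/13" "d < 5/13" using *(6-) i by linarith+
              then show thesis by (rule that(3))
            qed
          qed
        qed
        then show False
        proof cases
          case 1
          obtain p q r s :: int where *: "p + q + r + s = 9" "0 \<le> p" "p \<le> q" "q \<le> r" "r \<le> s"
            "p < 11 * a" "11 * a < real_of_int p + 1" "q < 11 * b" "11 * b < real_of_int q + 1"
            "r < 11 * c" "11 * c < real_of_int r + 1" "s < 11 * d" "11 * d < real_of_int s + 1"
            by (rule N[of 11]) auto
          have p: "p = 1" using *(6,7) \<open>1/9 < a\<close> \<open>a < 2/13\<close> by linarith+
          have q: "q = 2" using *(8,9) \<open>1/5 < b\<close> \<open>b < 2/9\<close> by linarith+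
          have r: "r = 3" using *(10,11) \<open>5/18 < c\<close> \<open>c < 4/13\<close> by linarith+
          have s: "s = 4" using *(12,13) \<open>5/13 < d\<close> \<open>d < 7/18\<close> by linarith+
          show False using *(1-5) p q r s by linarith
        next
          case 2
          obtain p q r s :: int where *: "p + q + r + s = 8" "0 \<le> p" "p \<le> q" "q \<le> r" "r \<le> s"
            "p < 10 * a" "10 * a < real_of_int p + 1" "q < 10 * b" "10 * b < real_of_int q + 1"
            "r < 10 * c" "10 * c < real_of_int r + 1" "s < 10 * d" "10 * d < real_of_int s + 1"
            by (rule N[of 10]) auto
          have p: "p = 1" using *(6,7) \<open>1/9 < a\<close> \<open>a < 2/13\<close> by linarith+
          have q: "q = 2" using *(8,9) \<open>1/5 < b\<close> \<open>b < 2/9\<close> by linarith+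
          have r: "r = 3" using *(10,11) \<open>4/13 < c\<close> \<open>c < 1/3\<close> by linarith+
          have s: "s = 3" using *(12,13) \<open>1/3 < d\<close> \<open>d < 5/13\<close> by linarith+
          show False using *(1-5) p q r s by linarith
        next
          case 3
          obtain p q r s :: int where *: "p + q + r + s = 13" "0 \<le> p" "p \<le> q" "q \<le> r" "r \<le> s"
            "p < 15 * a" "15 * a < real_of_int p + 1" "q < 15 * b" "15 * b < real_of_int q + 1"
            "r < 15 * c" "15 * c < real_of_int r + 1" "s < 15 * d" "15 * d < real_of_int s + 1"
            by (rule N[of 15]) auto
          have p: "p = 2" using *(6,7) \<open>2/13 < a\<close> \<open>a < 1/6\<close> by linarith+
          have q: "q = 3" using *(8,9) \<open>1/5 < b\<close> \<open>b < 2/9\<close> by linarith+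
          have r: "r = 4" using *(10,11) \<open>5/18 < c\<close> \<open>c < 4/13\<close> by linarith+
          have s: "s = 5" using *(12,13) \<open>1/3 < d\<close> \<open>d < 5/13\<close> by linarith+
          show False using *(1-5) p q r s by linarith
        qed
      qed
    qed
  qed
qed

text \<open>The values of h are exactly those from 2 to 19 missing from the list of the theorem.
  Weights a/h, ..., d/h with least period h would be balanced for every k from 2 to h - 2, since
  then k - 1, k, k + 1 all lie strictly between 0 and h. Evaluation finds a k refuting each
  candidate.\<close>

lemma no_balanced_weights:
  "\<forall>h\<in>set [6,8,9,10,12,14,15,16,18::nat].
     \<forall>a\<in>set [1..<h]. \<forall>b\<in>set [a..<h-a]. \<forall>c\<in>set [b..<h-a-b].
       \<exists>k\<in>set [2..<h-1]. let d = h - a - b - c in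
         k * a mod h = 0 \<or> k * b mod h = 0 \<or> k * c mod h = 0 \<or> k * d mod h = 0 \<or>
         k * a div h + k * b div h + k * c div h + k * d div h \<noteq> k - 2"
  by code_simp

text \<open>If u are the barycentric coordinates of 0 in a lattice simplex, then frac (k u) are those of a
  lattice point as soon as they sum to 1; the last assumption says that this point can only be 0, whose
  coordinates are u itself.\<close>
locale terminal_weights =
  fixes T :: "'a set" and u :: "'a \<Rightarrow> real"
  assumes finite_T: "finite T"
    and pos: "t \<in> T \<Longrightarrow> 0 < u t"
    and sum_1: "sum u T = 1"
    and terminal: "(\<Sum>t\<in>T. frac (of_int k * u t)) = 1 \<Longrightarrow> t \<in> T \<Longrightarrow> of_int (k - 1) * u t \<in> \<int>"
begin

definition period :: "int \<Rightarrow> bool" where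
  "period k \<longleftrightarrow> (\<forall>t\<in>T. of_int k * u t \<in> \<int>)"

lemma sum_frac: "(\<Sum>t\<in>T. frac (of_int k * u t)) = of_int (k - (\<Sum>t\<in>T. \<lfloor>of_int k * u t\<rfloor>))"
  by (simp add: frac_def sum_subtractf sum_distrib_left[symmetric] sum_1)

text \<open>The fractional parts of k u and of -k u sum to positive integers whose total is the
  number of non-integral k u_t. Neither sum is 1, because \<open>terminal\<close> would then make k
  - 1 or k + 1 a period. So both are at least 2, and four weights force equality and non-integrality
  throughout.\<close>

lemma balanced:
  assumes "\<not> period (k - 1)" "\<not> period k" "\<not> period (k + 1)"
  shows "4 \<le> card T"
    and "card T = 4 \<Longrightarrow> (\<forall>t\<in>T. of_int k * u t \<notin> \<int>) \<and> (\<Sum>t\<in>T. \<lfloor>of_int k * u t\<rfloor>) = k - 2"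
proof -
  define J where "J = {t \<in> T. of_int k * u t \<notin> \<int>}"
  define m where "m = k - (\<Sum>t\<in>T. \<lfloor>of_int k * u t\<rfloor>)"
  have J: "finite J" "J \<subseteq> T" "J \<noteq> {}"
    using finite_T assms(2) by (auto simp: J_def period_def)
  have cJ: "card J \<le> card T"
    using J finite_T by (simp add: card_mono)
  have S: "(\<Sum>t\<in>T. frac (of_int k * u t)) = of_int m"
    by (simp add: sum_frac m_def)
  have SJ: "(\<Sum>t\<in>T. frac (of_int k * u t)) = (\<Sum>t\<in>J. frac (of_int k * u t))"
    using J finite_T by (intro sum.mono_neutral_right) (auto simp: J_def)
  have "(\<Sum>t\<in>J. frac (of_int k * u t)) > 0"
    using J by (intro sum_pos) (auto simp: J_def)
  then have m0: "m > 0" using S SJ by simp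
  have m1: "m \<noteq> 1"
    using terminal[of k] S assms(1) by (auto simp: period_def)
  \<comment> \<open>On \<open>J\<close> the fractional parts of k u_t and -k u_t add up to 1, and
    off \<open>J\<close> both vanish; so the sum for -k is \<open>card J - m\<close>.\<close>
  have "(\<Sum>t\<in>T. frac (of_int (-k) * u t)) = (\<Sum>t\<in>J. frac (of_int (-k) * u t))"
    using J finite_T by (intro sum.mono_neutral_right) (auto simp: J_def)
  also have "\<dots> = (\<Sum>t\<in>J. 1 - frac (of_int k * u t))"
    by (intro sum.cong) (auto simp: J_def frac_neg)
  also have "\<dots> = of_int (card J - m)"
    using S SJ by (simp add: sum_subtractf)
  finally have S': "(\<Sum>t\<in>T. frac (of_int (-k) * u t)) = of_int (card J - m)" .
  have "(\<Sum>t\<in>J. 1 - frac (of_int k * u t)) > 0"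
    using J by (intro sum_pos) (auto simp: frac_lt_1)
  then have n0: "card J - m > 0"
    using S SJ by (simp add: sum_subtractf)
  have n1: "card J - m \<noteq> 1"
  proof
    assume "card J - m = 1"
    then have "of_int (-k - 1) * u t \<in> \<int>" if "t \<in> T" for t
      using terminal[of "-k" t] S' that by simp
    then have "- (of_int (-k - 1) * u t) \<in> \<int>" if "t \<in> T" for t
      using that Ints_minus by blast
    then have "period (k + 1)"
      by (auto simp: period_def algebra_simps)
    with assms show False by simp
  qed
  show "4 \<le> card T"
    using m0 m1 n0 n1 cJ by linarith
  assume "card T = 4"
  then have "card J = card T" "m = 2"
    using m0 m1 n0 n1 cJ by linarith+
  then have "J = T" using J finite_T by (simp add: card_subset_eq)
  then show "(\<forall>t\<in>T. of_int k * u t \<notin> \<int>) \<and> (\<Sum>t\<in>T. \<lfloor>of_int k * u t\<rfloor>) = k - 2"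
    using \<open>m = 2\<close> by (auto simp: J_def m_def)
qed

lemma less_1:
  assumes "2 \<le> card T" "t \<in> T"
  shows "u t < 1"
proof -
  have "T - {t} \<noteq> {}"
    using assms card_mono[of "{t}" T] by auto
  then have "sum u (T - {t}) > 0"
    using finite_T pos by (intro sum_pos) auto
  then show ?thesis
    using sum_1 sum.remove[OF finite_T assms(2), of u] by simp
qed

text \<open>At least two positive weights of sum 1 all lie strictly between 0 and 1.\<close>

lemma not_period_1: "2 \<le> card T \<Longrightarrow> \<not> period 1"
proof
  assume c: "2 \<le> card T" and p: "period 1"
  then obtain t where t: "t \<in> T" by fastforce
  then have "u t \<in> \<int>" using p by (simp add: period_def)
  then show False using pos[OF t] less_1[OF c t] by (auto elim!: Ints_cases)
qed

text \<open>If no number from 1 to 19 is a period, \<open>balanced\<close> applies to every k from 2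
  to 18, because k - 1 and k + 1 stay in that range. This is the hypothesis that the search tree
  refutes.\<close>

lemma period_bound:
  assumes T: "T = {w, x, y, z}" "card T = 4" and ord: "u w \<le> u x" "u x \<le> u y" "u y \<le> u z"
  shows "\<exists>m\<in>{1..19}. period m"
proof (rule ccontr)
  assume "\<not> ?thesis"
  then have np: "\<not> period m" if "m \<in> {1..19}" for m using that by blast
  have dist: "w \<noteq> x" "w \<noteq> y" "w \<noteq> z" "x \<noteq> y" "x \<noteq> z" "y \<noteq> z"
    using T by (auto simp: card_insert_if split: if_splits)
  have fl: "of_int \<lfloor>r\<rfloor> < r \<and> r < of_int \<lfloor>r\<rfloor> + 1" if "r \<notin> \<int>" for r :: real
    using that by (metis Ints_of_int floor_correct order_le_imp_less_or_eq of_int_1 of_int_add)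
  show False
  proof (rule balanced_reals_contradiction[of "u w" "u x" "u y" "u z"])
    show "0 < u w" "u w + u x + u y + u z = 1"
      using pos sum_1 dist T by auto
    fix k :: int assume k: "k \<in> {2..18}"
    then have "(\<forall>t\<in>T. of_int k * u t \<notin> \<int>) \<and> (\<Sum>t\<in>T. \<lfloor>of_int k * u t\<rfloor>) = k - 2"
      using np T(2) by (intro balanced) auto
    then have nonint: "of_int k * u w \<notin> \<int>" "of_int k * u x \<notin> \<int>" "of_int k * u y \<notin> \<int>" "of_int k * u z \<notin> \<int>"
      and "\<lfloor>of_int k * u w\<rfloor> + \<lfloor>of_int k * u x\<rfloor> + \<lfloor>of_int k * u y\<rfloor> + \<lfloor>of_int k * u z\<rfloor> = k - 2"
      using T(1) dist by (auto simp: add.assoc)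
    then show "\<exists>p q r s. p + q + r + s = k - 2 \<and>
       real_of_int p < real_of_int k * u w \<and> real_of_int k * u w < real_of_int p + 1 \<and>
       real_of_int q < real_of_int k * u x \<and> real_of_int k * u x < real_of_int q + 1 \<and>
       real_of_int r < real_of_int k * u y \<and> real_of_int k * u y < real_of_int r + 1 \<and>
       real_of_int s < real_of_int k * u z \<and> real_of_int k * u z < real_of_int s + 1"
      using nonint[THEN fl] by blast
  qed (use ord in auto)
qed

text \<open>Weights of period h are n_t/h with positive integers n_t of sum h, so they occur in the
  finite table. The k found there contradicts \<open>balanced\<close>, as no positive number below h
  is a period.\<close>

lemma least_period_cases:
  assumes T: "T = {w, x, y, z}" "card T = 4" and ord: "u w \<le> u x" "u x \<le> u y" "u y \<le> u z"
    and h: "0 < h" "period (int h)" and least: "\<And>m. 0 < m \<Longrightarrow> m < h \<Longrightarrow> \<not> period (int m)"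
  shows "h \<notin> set [6,8,9,10,12,14,15,16,18]"
proof
  assume hs: "h \<in> set [6,8,9,10,12,14,15,16,18]"
  have dist: "w \<noteq> x" "w \<noteq> y" "w \<noteq> z" "x \<noteq> y" "x \<noteq> z" "y \<noteq> z"
    using T by (auto simp: card_insert_if split: if_splits)
  have "\<exists>n::nat. 0 < n \<and> u t = real n / real h" if "t \<in> T" for t
  proof -
    have "real h * u t \<in> \<int>"
      using h(2) that by (simp add: period_def)
    then obtain i where i: "real h * u t = of_int i"
      by (rule Ints_cases)
    have "0 < real h * u t" using h pos[OF that] by simp
    then have "i > 0" using i by simp
    then show ?thesis using i h by (intro exI[of _ "nat i"]) (simp add: field_simps)
  qed
  then obtain n where n: "\<And>t. t \<in> T \<Longrightarrow> 0 < n t \<and> u t = real (n t) / real h"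
    by metis
  define a b c d where abcd: "a = n w" "b = n x" "c = n y" "d = n z"
  have u: "u w = a / h" "u x = b / h" "u y = c / h" "u z = d / h" "0 < a" "0 < b" "0 < c" "0 < d"
    using n T by (auto simp: abcd)
  have "u w + u x + u y + u z = 1" using sum_1 dist T by auto
  then have "real a + real b + real c + real d = real h"
    using h by (simp add: u field_simps)
  then have sum: "a + b + c + d = h" by linarith
  have le: "a \<le> b" "b \<le> c" "c \<le> d"
    using ord h by (auto simp: u divide_le_cancel)
  have d: "h - a - b - c = d" using sum by simp
  have abc: "a \<in> set [1..<h]" "b \<in> set [a..<h-a]" "c \<in> set [b..<h-a-b]"
    using u le sum by auto
  obtain k where k: "k \<in> set [2..<h-1]"
    "k * a mod h = 0 \<or> k * b mod h = 0 \<or> k * c mod h = 0 \<or> k * d mod h = 0 \<or>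
         k * a div h + k * b div h + k * c div h + k * d div h \<noteq> k - 2"
    by (rule no_balanced_weights[rule_format, OF hs abc, unfolded Let_def d, THEN bexE])
  have kh: "0 < k - 1" "k - 1 < h" "0 < k" "k < h" "0 < k + 1" "k + 1 < h"
    using k(1) by auto
  have "\<not> period (int k - 1)" "\<not> period (int k)" "\<not> period (int k + 1)"
    using least[of "k - 1"] least[of k] least[of "k + 1"] kh by (simp_all add: of_nat_diff add.commute)
  from balanced(2)[OF this T(2)]
  have bal: "\<forall>t\<in>T. real k * u t \<notin> \<int>" "(\<Sum>t\<in>T. \<lfloor>real k * u t\<rfloor>) = int k - 2"
    by auto
  \<comment> \<open>Natural-number division computes the floors, which carries the balance condition
    over to the form of the table.\<close>
  have fl: "\<lfloor>real k * (real j / real h)\<rfloor> = int (k * j div h)" for j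
    using floor_divide_of_nat_eq[of "k * j" h, where ?'a = real] by simp
  have "\<lfloor>real k * u w\<rfloor> + \<lfloor>real k * u x\<rfloor> + \<lfloor>real k * u y\<rfloor> + \<lfloor>real k * u z\<rfloor> = int k - 2"
    using bal(2) T(1) dist by (auto simp: add.assoc)
  then have s: "k * a div h + k * b div h + k * c div h + k * d div h = k - 2"
    unfolding u fl by linarith
  have ni: "k * j mod h \<noteq> 0" if "real k * (real j / real h) \<notin> \<int>" for j
  proof
    assume "k * j mod h = 0"
    then obtain l where "k * j = h * l" by auto
    then have "real k * real j = real h * real l" by (metis of_nat_mult)
    then have "real k * (real j / real h) = real l" using h by (simp add: field_simps)
    then show False using that by simp
  qed
  have "k * a mod h \<noteq> 0" "k * b mod h \<noteq> 0" "k * c mod h \<noteq> 0" "k * d mod h \<noteq> 0"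
    by (rule ni; use bal(1) T(1) in \<open>simp add: u(1-4)[symmetric]\<close>)+
  with s k(2) show False by blast
qed

lemma obtain_sorted:
  assumes "card T = 4"
  obtains w x y z where "T = {w, x, y, z}" "u w \<le> u x" "u x \<le> u y" "u y \<le> u z"
proof -
  obtain xs where xs: "set xs = T" "distinct xs" using finite_distinct_list[OF finite_T] by blast
  define ys where "ys = sort_key u xs"
  have "length ys = 4" "set ys = T" "sorted (map u ys)"
    using assms xs distinct_card by (fastforce simp: ys_def)+
  moreover then obtain w x y z where "ys = [w, x, y, z]"
    by (auto simp: numeral_eq_Suc length_Suc_conv)
  ultimately show ?thesis using that[of w x y z] by auto
qed

text \<open>With two or three weights \<open>balanced\<close> must fail at k = 2, so 2 or 3 is a
  period, 1 being excluded. With four weights the least period is at most 19, is not 1 and avoids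
  the values of the table.\<close>

lemma period_cases:
  assumes "2 \<le> card T" "card T \<le> 4"
  shows "\<exists>h\<in>{2,3,4,5,7,11,13,17,19::nat}. period (int h)"
proof (cases "card T = 4")
  case False
  then have "period 1 \<or> period 2 \<or> period 3"
    using balanced(1)[of 2] assms by auto
  then show ?thesis using not_period_1[OF assms(1)] by auto
next
  case True
  obtain w x y z where T: "T = {w, x, y, z}" "u w \<le> u x" "u x \<le> u y" "u y \<le> u z"
    using obtain_sorted[OF True] .
  define h where "h = (LEAST m::nat. 0 < m \<and> period (int m))"
  obtain m where m: "m \<in> {1..19}" "period m"
    using period_bound[OF T(1) True T(2-4)] by blast
  then have m': "0 < nat m \<and> period (int (nat m))" by simp
  have h: "0 < h" "period (int h)" using LeastI[where P="\<lambda>m. 0 < m \<and> period (int m)", OF m'] by (auto simp: h_def)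
  have least: "\<not> period (int j)" if "0 < j" "j < h" for j
    using that not_less_Least unfolding h_def by blast
  have "h \<le> nat m" unfolding h_def by (rule Least_le) (rule m')
  then have "h \<le> 19" using m by auto
  moreover have "h \<noteq> 1" using h not_period_1[OF assms(1)] by auto
  moreover have "h \<notin> set [6,8,9,10,12,14,15,16,18]"
    using least_period_cases[OF T(1) True T(2-4) h least] .
  moreover have "h \<in> {2,3,4,5,7,11,13,17,19} \<or> h = 1 \<or> h \<in> set [6,8,9,10,12,14,15,16,18]" if "0 < h" "h \<le> 19"
  proof -
    have "h \<in> {0..19}" using that by simp
    then have "h \<in> set [0..<20]" by simp
    then show ?thesis using that by (auto simp: upt_rec)
  qed
  ultimately show ?thesis using h by blast
qed

end

section \<open>Empty lattice simplices around the origin\<close>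

lemma int_vec_sum:
  assumes "\<And>t. t \<in> T \<Longrightarrow> int_vec t"
  shows "int_vec (\<Sum>t\<in>T. of_int (n t) *\<^sub>R t)"
  using assms unfolding int_vec_def by (auto simp: sum_component intro!: Ints_sum Ints_mult)

lemma int_vec_uminus: "int_vec a \<Longrightarrow> int_vec (- a)"
  by (simp add: int_vec_def)

lemma int_vec_axis: "int_vec (axis i 1)"
  by (simp add: int_vec_def axis_def)

lemma int_vec_inner: "int_vec a \<Longrightarrow> int_vec b \<Longrightarrow> a \<bullet> b \<in> \<int>"
  by (auto simp: int_vec_def inner_vec_def intro!: Ints_sum Ints_mult)

lemma int_vec_norm_ge_1:
  assumes "int_vec a" "a \<noteq> 0"
  shows "1 \<le> norm a"
proof -
  obtain i where i: "a $ i \<noteq> 0"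
    using assms(2) by (auto simp: vec_eq_iff)
  then have "1 \<le> \<bar>a $ i\<bar>"
    using assms(1) Ints_nonzero_abs_ge1 by (auto simp: int_vec_def)
  then show ?thesis
    using component_le_norm_cart[of a i] by linarith
qed

lemma finite_int_vec_bounded: "finite {a. int_vec a \<and> norm a \<le> R}"
proof (rule finite_subset)
  define B where "B = {-\<lceil>R\<rceil>..\<lceil>R\<rceil>}"
  show "{a. int_vec a \<and> norm a \<le> R} \<subseteq> (\<lambda>p. \<chi> i. of_int (p i)) ` (PiE UNIV (\<lambda>_::3. B))"
  proof
    fix a :: "real^3" assume "a \<in> {a. int_vec a \<and> norm a \<le> R}"
    then have a: "int_vec a" "norm a \<le> R" by auto
    have fl: "a $ i = of_int \<lfloor>a $ i\<rfloor>" for i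
      using a by (simp add: int_vec_def)
    have "\<lfloor>a $ i\<rfloor> \<in> B" for i
    proof -
      have "\<bar>a $ i\<bar> \<le> R"
        using component_le_norm_cart[of a i] a by linarith
      then have "a $ i \<le> of_int \<lceil>R\<rceil>" "- of_int \<lceil>R\<rceil> \<le> a $ i"
        by linarith+
      then show ?thesis
        using fl[of i] unfolding B_def atLeastAtMost_iff by linarith
    qed
    moreover have "a = (\<chi> i. of_int \<lfloor>a $ i\<rfloor>)"
      using fl by (simp add: vec_eq_iff)
    ultimately show "a \<in> (\<lambda>p. \<chi> i. of_int (p i)) ` (PiE UNIV (\<lambda>_::3. B))"
      by (intro image_eqI[where x="\<lambda>i. \<lfloor>a $ i\<rfloor>"]) auto
  qed
qed (auto intro!: finite_imageI finite_PiE)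

section \<open>Barycentric coordinates and exchange of vertices\<close>

lemma barycentric_unique:
  fixes T :: "'a::euclidean_space set"
  assumes "\<not> affine_dependent T" "sum u T = sum w T"
    "(\<Sum>t\<in>T. u t *\<^sub>R t) = (\<Sum>t\<in>T. w t *\<^sub>R t)" "t \<in> T"
  shows "u t = w t"
proof (rule ccontr)
  assume "u t \<noteq> w t"
  moreover have "finite T" using assms(1) by (rule aff_independent_finite)
  \<comment> \<open>The difference of the two coefficient vectors has sum 0 and is not zero at
    \<open>t\<close>, so it is an affine dependence.\<close>
  ultimately have "affine_dependent T"
    using assms(2-4) unfolding affine_dependent_explicit_finite[OF \<open>finite T\<close>]
    by (intro exI[of _ "\<lambda>t. u t - w t"]) (auto simp: sum_subtractf scaleR_left_diff_distrib)
  with assms(1) show False ..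
qed

text \<open>A vanishing coefficient could be dropped, which would put y into the hull of the
  remaining points.\<close>

lemma obtain_positive_coefficients:
  fixes T :: "'a::euclidean_space set"
  assumes "finite T" "y \<in> convex hull T" "\<And>t. t \<in> T \<Longrightarrow> y \<notin> convex hull (T - {t})"
  obtains u where "\<And>t. t \<in> T \<Longrightarrow> 0 < u t" "sum u T = 1" "(\<Sum>t\<in>T. u t *\<^sub>R t) = y"
proof -
  obtain u where u: "\<forall>t\<in>T. 0 \<le> u t" "sum u T = 1" "(\<Sum>t\<in>T. u t *\<^sub>R t) = y"
    using assms(2) unfolding convex_hull_finite[OF assms(1)] by blast
  have "u t \<noteq> 0" if t: "t \<in> T" for t
  proof
    assume "u t = 0"
    then have "sum u (T - {t}) = 1" "(\<Sum>t\<in>T - {t}. u t *\<^sub>R t) = y"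
      using u sum.remove[OF assms(1) t, of u] sum.remove[OF assms(1) t, of "\<lambda>t. u t *\<^sub>R t"] by auto
    then have "y \<in> convex hull (T - {t})"
      using u(1) assms(1) unfolding convex_hull_finite[OF finite_Diff[OF assms(1)]] by blast
    with assms(3) t show False by blast
  qed
  with u(1) have "\<And>t. t \<in> T \<Longrightarrow> 0 < u t" by (simp add: order_less_le)
  with u that show ?thesis by blast
qed

text \<open>The pivot step of the simplex method: b enters and some t leaves while y stays in the
  hull. That t really drops out of the hull is what makes the number of lattice points decrease
  later.\<close>

lemma replace_vertex:
  fixes T :: "'a::euclidean_space set"
  assumes T: "\<not> affine_dependent T"
    and u: "\<And>t. t \<in> T \<Longrightarrow> 0 < u t" "sum u T = 1" "(\<Sum>t\<in>T. u t *\<^sub>R t) = y"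
    and b: "b \<in> convex hull T" "b \<notin> T"
  obtains t where "t \<in> T" "y \<in> convex hull (insert b (T - {t}))" "t \<notin> convex hull (insert b (T - {t}))"
proof -
  have fin: "finite T" using T by (rule aff_independent_finite)
  obtain w where w: "\<forall>t\<in>T. 0 \<le> w t" "sum w T = 1" "(\<Sum>t\<in>T. w t *\<^sub>R t) = b"
    using b(1) unfolding convex_hull_finite[OF fin] by blast
  define J where "J = {t \<in> T. 0 < w t}"
  have "J \<noteq> {}"
  proof
    assume "J = {}"
    then have "w t = 0" if "t \<in> T" for t using w(1) that by (force simp: J_def)
    then have "sum w T = 0" by simp
    with w(2) show False by simp
  qed
  moreover have "finite J" using fin by (simp add: J_def)
  \<comment> \<open>Ratio test: t minimises u_t/w_t over positive w_t, so subtracting c times w from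
    u makes the coefficient of t vanish and keeps all others non-negative.\<close>
  ultimately obtain t where t: "t \<in> J" "\<And>s. s \<in> J \<Longrightarrow> u t / w t \<le> u s / w s"
    using ex_min_if_finite[of "(\<lambda>t. u t / w t) ` J"] by (auto simp: not_less)
  define c where "c = u t / w t"
  have tT: "t \<in> T" "0 < w t" using t(1) by (auto simp: J_def)
  have c: "0 < c" using tT u(1) by (simp add: c_def)
  have nonneg: "0 \<le> u s - c * w s" if "s \<in> T" for s
  proof (cases "s \<in> J")
    case True
    then have "c \<le> u s / w s" "0 < w s" using t(2) by (auto simp: c_def J_def)
    then show ?thesis by (simp add: pos_le_divide_eq)
  next
    case False
    then show ?thesis using that w(1) u(1)[OF that] by (force simp: J_def)
  qed
  define T' where "T' = insert b (T - {t})"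
  \<comment> \<open>Coefficients of y after the pivot, from y = (y - c b) + c b.\<close>
  define v where "v s = (if s = b then c else u s - c * w s)" for s
  have fin': "finite (T - {t})" using fin by simp
  have nb: "b \<notin> T - {t}" using b(2) by blast
  have t0: "u t - c * w t = 0" using tT by (simp add: c_def)
  have v_eq: "v s = u s - c * w s" if "s \<in> T" for s
    using that b(2) by (auto simp: v_def)
  have "sum v (T - {t}) = (\<Sum>s\<in>T - {t}. u s - c * w s)"
    by (intro sum.cong) (auto simp: v_eq)
  also have "\<dots> = (\<Sum>s\<in>T. u s - c * w s)"
    using sum.remove[OF fin tT(1), of "\<lambda>s. u s - c * w s"] t0 by simp
  also have "\<dots> = 1 - c"
    by (simp add: sum_subtractf u(2) w(2) flip: sum_distrib_left)
  finally have sum_v: "sum v T' = 1"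
    using fin' nb by (simp add: T'_def v_def)
  have "(\<Sum>s\<in>T - {t}. v s *\<^sub>R s) = (\<Sum>s\<in>T - {t}. (u s - c * w s) *\<^sub>R s)"
    by (intro sum.cong) (auto simp: v_eq)
  also have "\<dots> = (\<Sum>s\<in>T. (u s - c * w s) *\<^sub>R s)"
    using sum.remove[OF fin tT(1), of "\<lambda>s. (u s - c * w s) *\<^sub>R s"] t0 by simp
  also have "\<dots> = (\<Sum>s\<in>T. u s *\<^sub>R s) - c *\<^sub>R (\<Sum>s\<in>T. w s *\<^sub>R s)"
    by (simp add: sum_subtractf scaleR_left_diff_distrib scaleR_sum_right)
  also have "\<dots> = y - c *\<^sub>R b" by (simp add: u(3) w(3))
  finally have "(\<Sum>s\<in>T'. v s *\<^sub>R s) = y"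
    using fin' nb by (simp add: T'_def v_def)
  moreover have "\<forall>s\<in>T'. 0 \<le> v s"
    using nonneg c by (auto simp: T'_def v_def)
  moreover have "finite T'" using fin by (simp add: T'_def)
  ultimately have y: "y \<in> convex hull T'"
    using sum_v convex_hull_finite by blast
  have "T' \<subseteq> convex hull T"
    using b(1) hull_subset[of T convex] by (auto simp: T'_def)
  then have sub: "convex hull T' \<subseteq> convex hull T"
    by (simp add: hull_minimal)
  \<comment> \<open>As a vertex of the old simplex, t is extreme in any subset of it that contains
    t; an extreme point of the hull of \<open>T'\<close> would be one of the points of
    \<open>T'\<close>.\<close>
  have "t \<notin> convex hull T'"
  proof
    assume "t \<in> convex hull T'"
    moreover have "t extreme_point_of (convex hull T)"
      using T tT(1) by (simp add: extreme_point_of_convex_hull_affine_independent)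
    ultimately have "t extreme_point_of (convex hull T')"
      using sub unfolding extreme_point_of_def by blast
    then have "t \<in> T'" by (rule extreme_point_of_convex_hull)
    with tT(1) b(2) show False by (auto simp: T'_def)
  qed
  with y tT(1) that show ?thesis by (auto simp: T'_def)
qed

text \<open>In the minimised quantity, the cardinality makes T minimal around 0, hence affinely
  independent by Caratheodory; the count of points of A rules out further lattice points, because a
  pivot at such a point would lower it.\<close>

lemma obtain_empty_simplex:
  fixes A :: "(real^3) set"
  assumes fin: "finite A" and zero: "0 \<in> convex hull A"
    and closed: "\<And>b. int_vec b \<Longrightarrow> b \<noteq> 0 \<Longrightarrow> b \<in> convex hull A \<Longrightarrow> b \<in> A"
  obtains T where "T \<subseteq> A" "\<not> affine_dependent T" "0 \<in> convex hull T"
    "\<And>t. t \<in> T \<Longrightarrow> 0 \<notin> convex hull (T - {t})"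
    "\<And>b. int_vec b \<Longrightarrow> b \<noteq> 0 \<Longrightarrow> b \<in> convex hull T \<Longrightarrow> b \<in> T"
proof -
  define m where "m T = card (A \<inter> convex hull T) + card T" for T
  obtain T where T: "T \<subseteq> A" "0 \<in> convex hull T"
    and least: "\<And>S. S \<subseteq> A \<Longrightarrow> 0 \<in> convex hull S \<Longrightarrow> m T \<le> m S"
    using ex_has_least_nat[of "\<lambda>T. T \<subseteq> A \<and> 0 \<in> convex hull T" A m] zero by blast
  have finT: "finite T" using T(1) fin by (rule finite_subset)
  have psub: "0 \<notin> convex hull S" if "S \<subset> T" for S
  proof
    assume "0 \<in> convex hull S"
    then have "m T \<le> m S" using least[of S] that T(1) by blast
    moreover have "card S < card T" using finT that by (rule psubset_card_mono)
    moreover have "card (A \<inter> convex hull S) \<le> card (A \<inter> convex hull T)"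
      using fin that hull_mono[of S T convex] by (intro card_mono) auto
    ultimately show False by (simp add: m_def)
  qed
  \<comment> \<open>The Caratheodory subset cannot be proper, so T itself has at most
    \<open>aff_dim T + 1\<close> points.\<close>
  obtain S where S: "S \<subseteq> T" "int (card S) \<le> aff_dim T + 1" "0 \<in> convex hull S"
    using T(2) caratheodory_aff_dim[of T] by blast
  with psub have "S = T" by blast
  then have "aff_dim T = int (card T) - 1"
    using S(2) aff_dim_le_card[OF finT] by simp
  then have indep: "\<not> affine_dependent T"
    using finT by (simp add: affine_independent_iff_card)
  have minimal: "0 \<notin> convex hull (T - {t})" if "t \<in> T" for t
    using psub that by blast
  have "b \<in> T" if b: "int_vec b" "b \<noteq> 0" "b \<in> convex hull T" for b
  proof (rule ccontr)
    \<comment> \<open>Pivoting b into T keeps the cardinality and shrinks the hull, which loses the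
      point t of A.\<close>
    assume "b \<notin> T"
    obtain u where u: "\<And>t. t \<in> T \<Longrightarrow> 0 < u t" "sum u T = 1" "(\<Sum>t\<in>T. u t *\<^sub>R t) = 0"
      using obtain_positive_coefficients[OF finT T(2) minimal] by blast
    obtain t where t: "t \<in> T" "0 \<in> convex hull (insert b (T - {t}))" "t \<notin> convex hull (insert b (T - {t}))"
      using replace_vertex[OF indep u b(3) \<open>b \<notin> T\<close>] by blast
    let ?T = "insert b (T - {t})"
    have "b \<in> convex hull A"
      using hull_mono[OF T(1)] b(3) by (rule subsetD)
    then have "b \<in> A" by (rule closed[OF b(1,2)])
    then have "?T \<subseteq> A" using T(1) by blast
    then have le: "m T \<le> m ?T" using t(2) by (rule least)
    have "insert b (T - {t}) \<subseteq> convex hull T"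
      using b(3) hull_subset[of T convex] by blast
    then have "convex hull ?T \<subseteq> convex hull T" by (simp add: hull_minimal)
    moreover have "t \<in> convex hull T" "t \<in> A" using t(1) T(1) by (auto intro: hull_inc)
    ultimately have "A \<inter> convex hull ?T \<subset> A \<inter> convex hull T" using t(3) by blast
    then have "card (A \<inter> convex hull ?T) < card (A \<inter> convex hull T)"
      using fin by (intro psubset_card_mono) auto
    moreover have "card ?T = card T"
      using card_Suc_Diff1[OF finT t(1)] finT \<open>b \<notin> T\<close> by simp
    ultimately show False using le by (simp add: m_def)
  qed
  with T indep minimal that show ?thesis by blast
qed

section \<open>The maximal Fine adjoint\<close>

locale lattice_polytope =
  fixes V P :: "(real^3) set"
  assumes finite_V: "finite V" and V_nonempty: "V \<noteq> {}" and int_V: "v \<in> V \<Longrightarrow> int_vec v"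
    and P_def: "P = convex hull V" and dim_P: "aff_dim P = 3"
begin

text \<open>As a function of a this is the support function of x - P, hence sublinear and Lipschitz.
  The Fine adjoint of level s asks that it be at least s at all non-zero lattice vectors.\<close>

definition slack :: "real^3 \<Rightarrow> real^3 \<Rightarrow> real" where
  "slack x a = a \<bullet> x - hP P a"

lemma hP_attained:
  obtains v where "v \<in> V" "hP P a = a \<bullet> v" "\<And>x. x \<in> P \<Longrightarrow> a \<bullet> v \<le> a \<bullet> x"
proof -
  obtain v where v: "v \<in> V" "\<And>w. w \<in> V \<Longrightarrow> a \<bullet> v \<le> a \<bullet> w"
    using ex_min_if_finite[of "(\<lambda>w. a \<bullet> w) ` V"] finite_V V_nonempty by (auto simp: not_less)
  have "convex hull V \<subseteq> {x. a \<bullet> v \<le> a \<bullet> x}"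
    using v(2) by (intro hull_minimal) (auto simp: convex_halfspace_ge[of "a \<bullet> v" a, simplified])
  then have le: "a \<bullet> v \<le> a \<bullet> x" if "x \<in> P" for x using that by (auto simp: P_def)
  moreover have "v \<in> P" using v(1) by (simp add: P_def hull_inc)
  ultimately have "hP P a = a \<bullet> v"
    unfolding hP_def by (intro cInf_eq_minimum) auto
  with v(1) le that show ?thesis by blast
qed

lemma hP_le: "x \<in> P \<Longrightarrow> hP P a \<le> a \<bullet> x"
  using hP_attained[of a] by metis

lemma V_subset_P: "V \<subseteq> P"
  by (simp add: P_def hull_subset)

lemma hP_Ints: "int_vec a \<Longrightarrow> hP P a \<in> \<int>"
  using hP_attained[of a] int_V int_vec_inner by metis

text \<open>Sublinearity: the point of V minimising the combined functional bounds every single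
  minimum from above.\<close>

lemma slack_sum_le:
  assumes "\<And>t. t \<in> T \<Longrightarrow> 0 \<le> u t"
  shows "slack x (\<Sum>t\<in>T. u t *\<^sub>R t) \<le> (\<Sum>t\<in>T. u t * slack x t)"
proof -
  let ?a = "\<Sum>t\<in>T. u t *\<^sub>R t"
  obtain v where v: "v \<in> V" "hP P ?a = ?a \<bullet> v" using hP_attained[of ?a] by blast
  have "(\<Sum>t\<in>T. u t * hP P t) \<le> (\<Sum>t\<in>T. u t * (t \<bullet> v))"
    using v(1) V_subset_P assms by (intro sum_mono mult_left_mono hP_le) auto
  also have "\<dots> = hP P ?a" by (simp add: v(2) inner_sum_left)
  finally show ?thesis
    by (simp add: slack_def inner_sum_left right_diff_distrib sum_subtractf)
qed

lemma slack_scaleR_le: "0 \<le> c \<Longrightarrow> slack x (c *\<^sub>R a) \<le> c * slack x a"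
  using slack_sum_le[of "{a}" "\<lambda>_. c" x] by simp

text \<open>Comparing both slacks at a minimiser v of a bounds their difference by the inner product
  of a - b with x - v. The summand 1 in C only ensures positivity.\<close>

lemma slack_lipschitz:
  obtains C where "0 < C" "\<And>a b. slack x a \<le> slack x b + C * norm (a - b)"
proof
  define C where "C = 1 + (\<Sum>v\<in>V. norm (x - v))"
  show "0 < C" by (simp add: C_def sum_nonneg add_pos_nonneg)
  fix a b
  obtain v where v: "v \<in> V" "hP P a = a \<bullet> v" using hP_attained[of a] by blast
  have "norm (x - v) \<le> C"
    using member_le_sum[OF v(1), of "\<lambda>v. norm (x - v)"] finite_V by (simp add: C_def)
  have "hP P b \<le> b \<bullet> v" using v(1) V_subset_P by (intro hP_le) auto
  then have "slack x a - slack x b \<le> (a - b) \<bullet> (x - v)"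
    by (simp add: slack_def v(2) inner_diff_left inner_diff_right)
  also have "\<dots> \<le> norm (a - b) * norm (x - v)" by (rule norm_cauchy_schwarz)
  also have "\<dots> \<le> C * norm (a - b)"
    using mult_left_mono[OF \<open>norm (x - v) \<le> C\<close> norm_ge_zero[of "a - b"]] by (simp add: mult.commute)
  finally show "slack x a \<le> slack x b + C * norm (a - b)" by simp
qed

lemma fine_adjoint_iff: "x \<in> fine_adjoint P s \<longleftrightarrow> (\<forall>a. int_vec a \<and> a \<noteq> 0 \<longrightarrow> s \<le> slack x a)"
  by (auto simp: fine_adjoint_def slack_def)

text \<open>A unit vector of slack at most 0 has, by Dirichlet, a positive multiple close to a lattice
  vector, whose slack is then smaller than s.\<close>
lemma slack_pos:
  assumes x: "x \<in> fine_adjoint P s" and s: "0 < s" and a: "norm a = 1"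
  shows "0 < slack x a"
proof (rule ccontr)
  assume "\<not> 0 < slack x a"
  then have neg: "slack x a \<le> 0" by simp
  obtain C where C: "0 < C" "\<And>a b. slack x a \<le> slack x b + C * norm (a - b)"
    using slack_lipschitz[of x] by blast
  \<comment> \<open>Simultaneous approximation is indexed by natural numbers, so the three
    coordinates are enumerated.\<close>
  obtain h :: "nat \<Rightarrow> 3" where h: "bij_betw h {0..<3} UNIV"
    using ex_bij_betw_nat_finite[of "UNIV :: 3 set"] by auto
  \<comment> \<open>The bound 1 on e will keep the approximating lattice vector away from 0; the
    bound s/C makes the Lipschitz error at most s. Three coordinate errors of at most 1/N stay below
    e in total.\<close>
  define e where "e = min 1 (s / C)"
  have e: "0 < e" "e \<le> 1" "C * e \<le> s" using s C(1) by (auto simp: e_def min_def field_simps)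
  obtain N :: nat where N: "3 / e < real N" using reals_Archimedean2 by blast
  then have N0: "0 < N" using e(1) by (metis divide_pos_pos gr0I less_asym of_nat_0 zero_less_numeral)
  obtain q p where q: "0 < q" and p: "\<And>i. i < 3 \<Longrightarrow> \<bar>of_int q * a $ h i - of_int (p i)\<bar> < 1 / N"
    using Dirichlet_approx_simult[OF N0, of 3 "\<lambda>i. a $ h i"] by metis
  define b :: "real^3" where "b = (\<chi> j. of_int (p (inv_into {0..<3} h j)))"
  have comp: "\<bar>(b - of_int q *\<^sub>R a) $ j\<bar> \<le> 1 / N" for j
  proof -
    have "inv_into {0..<3} h j < 3" "h (inv_into {0..<3} h j) = j"
      using h bij_betw_inv_into_right[OF h, of j] inv_into_into[of j h "{0..<3}"]
      by (auto simp: bij_betw_def)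
    then show ?thesis
      using p[of "inv_into {0..<3} h j"] by (simp add: b_def abs_minus_commute)
  qed
  have "norm (b - of_int q *\<^sub>R a) \<le> (\<Sum>j\<in>UNIV. \<bar>(b - of_int q *\<^sub>R a) $ j\<bar>)"
    by (rule norm_le_l1_cart)
  also have "\<dots> \<le> (\<Sum>j\<in>(UNIV :: 3 set). 1 / N)" by (intro sum_mono comp)
  also have "\<dots> = 3 / N" by simp
  also have "\<dots> < e" using N N0 e(1) by (simp add: field_simps)
  finally have near: "norm (b - of_int q *\<^sub>R a) < e" .
  have "norm (of_int q *\<^sub>R a) \<ge> 1" using q a by simp
  then have "b \<noteq> 0" using near e(2) by auto
  moreover have "int_vec b" by (simp add: int_vec_def b_def)
  ultimately have "s \<le> slack x b" using x by (simp add: fine_adjoint_iff)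
  also have "\<dots> \<le> slack x (of_int q *\<^sub>R a) + C * norm (b - of_int q *\<^sub>R a)" by (rule C(2))
  also have "\<dots> < of_int q * slack x a + C * e"
    using slack_scaleR_le[of "of_int q" x a] q near C(1) by (intro add_le_less_mono) auto
  also have "\<dots> \<le> s"
    using neg q e(3) by (smt (verit) mult_nonneg_nonpos of_int_pos)
  finally show False by simp
qed

text \<open>The slack is continuous and positive on the compact unit sphere; its minimum there is
  the constant r, by homogeneity.\<close>

lemma slack_coercive:
  assumes "x \<in> fine_adjoint P s" "0 < s"
  obtains r where "0 < r" "\<And>a. r * norm a \<le> slack x a"
proof -
  obtain C where C: "0 < C" "\<And>a b. slack x a \<le> slack x b + C * norm (a - b)"
    using slack_lipschitz[of x] by blast
  have "\<bar>slack x a - slack x b\<bar> \<le> C * norm (a - b)" for a b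
    using C(2)[of a b] C(2)[of b a] by (simp add: norm_minus_commute abs_le_iff)
  then have "C-lipschitz_on (sphere 0 1) (slack x)"
    using C(1) by (intro lipschitz_onI) (auto simp: dist_norm)
  then have "continuous_on (sphere 0 1) (slack x)" by (rule lipschitz_on_continuous_on)
  moreover have "axis 1 1 \<in> (sphere 0 1 :: (real^3) set)" by simp
  ultimately obtain z where z: "z \<in> sphere 0 1" "\<And>a. a \<in> sphere 0 1 \<Longrightarrow> slack x z \<le> slack x a"
    using continuous_attains_inf[of "sphere 0 1" "slack x"] by (metis compact_sphere empty_iff)
  have "slack x z * norm a \<le> slack x a" for a
  proof (cases "a = 0")
    case True
    have "hP P 0 = 0" using hP_attained[of 0] by (metis inner_zero_left)
    then show ?thesis using True by (simp add: slack_def)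
  next
    case False
    then have "slack x z \<le> slack x ((1 / norm a) *\<^sub>R a)" by (intro z(2)) simp
    also have "\<dots> \<le> (1 / norm a) * slack x a" by (rule slack_scaleR_le) simp
    finally show ?thesis using False by (simp add: field_simps)
  qed
  moreover have "0 < slack x z" using slack_pos[OF assms] z(1) by simp
  ultimately show ?thesis using that by blast
qed

text \<open>Let a ball of radius e around x lie in P. Moving from x by e against a stays in P and
  lowers the functional by e times the norm of a, which is at least e for non-zero lattice
  vectors.\<close>

lemma fine_adjoint_pos_nonempty:
  obtains s where "0 < s" "fine_adjoint P s \<noteq> {}"
proof -
  have "affine hull P = UNIV" using dim_P by (simp flip: aff_dim_eq_full)
  moreover have "rel_interior P \<noteq> {}"
    using V_nonempty by (simp add: P_def rel_interior_eq_empty)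
  ultimately obtain x where "x \<in> interior P" using rel_interior_interior by blast
  then obtain e where e: "0 < e" "cball x e \<subseteq> P" by (auto simp: mem_interior_cball)
  have "e \<le> slack x a" if a: "int_vec a" "a \<noteq> 0" for a
  proof -
    have "x - (e / norm a) *\<^sub>R a \<in> cball x e" using e(1) a(2) by (simp add: dist_norm)
    then have "hP P a \<le> a \<bullet> (x - (e / norm a) *\<^sub>R a)" using e(2) by (intro hP_le) blast
    also have "\<dots> = a \<bullet> x - e * norm a"
      using a(2) by (simp add: inner_diff_right power2_norm_eq_inner[symmetric] power2_eq_square)
    also have "\<dots> \<le> a \<bullet> x - e" using int_vec_norm_ge_1[OF a] e(1) by simp
    finally show ?thesis by (simp add: slack_def)
  qed
  then have "x \<in> fine_adjoint P e" by (simp add: fine_adjoint_iff)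
  with e(1) that show ?thesis by blast
qed

text \<open>The pairs (x, s) with x in the adjoint of level s form a compact set, on which the
  second coordinate attains its maximum.\<close>

lemma maximal_adjoint:
  obtains x s where "0 < s" "x \<in> fine_adjoint P s"
    "\<And>s'. 0 < s' \<Longrightarrow> fine_adjoint P s' \<noteq> {} \<Longrightarrow> s' \<le> s"
proof -
  \<comment> \<open>Allowing s = 0 keeps the set closed; positivity of the maximum comes from the
    positive level \<open>s0\<close>.\<close>
  define C where "C = {z. 0 \<le> snd z \<and> (\<forall>a. int_vec a \<and> a \<noteq> 0 \<longrightarrow> hP P a + snd z \<le> a \<bullet> fst z)}"
  have C_iff: "(x, s) \<in> C \<longleftrightarrow> 0 \<le> s \<and> x \<in> fine_adjoint P s" for x s
    by (auto simp: C_def fine_adjoint_def)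
  \<comment> \<open>The inequalities of the lattice vectors e_i and -e_i alone confine x to a box
    and bound s.\<close>
  define l :: "real^3" where "l = (\<chi> i. hP P (axis i 1))"
  define m :: "real^3" where "m = (\<chi> i. - hP P (- axis i 1))"
  have sub: "C \<subseteq> cbox l m \<times> {0..m $ 1 - l $ 1}"
  proof
    fix z assume z: "z \<in> C"
    have ax: "int_vec (axis i 1)" "axis i 1 \<noteq> (0 :: real^3)" "int_vec (- axis i 1)"
      "- axis i 1 \<noteq> (0 :: real^3)" for i
      using int_vec_axis int_vec_uminus by (auto simp: axis_eq_0_iff)
    have K: "hP P a + snd z \<le> a \<bullet> fst z" if "int_vec a" "a \<noteq> 0" for a
      using z that by (simp add: C_def)
    have "hP P (axis i 1) + snd z \<le> fst z $ i" "hP P (- axis i 1) + snd z \<le> - (fst z $ i)" for i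
      using K[OF ax(1,2)[of i]] K[OF ax(3,4)[of i]] by (simp_all add: inner_axis')
    then have "l $ i + snd z \<le> fst z $ i" "fst z $ i + snd z \<le> m $ i" "0 \<le> snd z" for i
      using z by (auto simp: l_def m_def C_def) (smt (verit))
    then have "l $ i \<le> fst z $ i" "fst z $ i \<le> m $ i" "0 \<le> snd z" "snd z \<le> m $ 1 - l $ 1" for i
      by (smt (verit))+
    then show "z \<in> cbox l m \<times> {0..m $ 1 - l $ 1}"
      by (auto simp: mem_Times_iff mem_box_cart)
  qed
  have "closed C"
    unfolding C_def
    by (intro closed_Collect_conj closed_Collect_all closed_Collect_imp closed_Collect_le
        continuous_intros open_Collect_const)
  moreover have "bounded C"
    by (rule bounded_subset[OF _ sub]) (intro bounded_Times bounded_cbox bounded_closed_interval)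
  ultimately have "compact C" by (simp add: compact_eq_bounded_closed)
  moreover obtain s0 where s0: "0 < s0" "fine_adjoint P s0 \<noteq> {}"
    using fine_adjoint_pos_nonempty by blast
  then obtain x0 where x0: "(x0, s0) \<in> C" by (auto simp: C_iff)
  ultimately obtain z where z: "z \<in> C" "\<And>y. y \<in> C \<Longrightarrow> snd y \<le> snd z"
    using continuous_attains_sup[of C snd] continuous_on_snd[OF continuous_on_id] by (metis empty_iff)
  show ?thesis
  proof (rule that[of "snd z" "fst z"])
    show "0 < snd z" using z(2)[OF x0] s0(1) by simp
    show "fst z \<in> fine_adjoint P (snd z)" using z(1) C_iff[of "fst z" "snd z"] by simp
    fix s' assume "0 < s'" "fine_adjoint P s' \<noteq> {}"
    then obtain x' where "(x', s') \<in> C" by (auto simp: C_iff)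
    then show "s' \<le> snd z" using z(2) by fastforce
  qed
qed

definition active :: "real^3 \<Rightarrow> real \<Rightarrow> (real^3) set" where
  "active x s = {a. int_vec a \<and> a \<noteq> 0 \<and> slack x a = s}"

lemma finite_slack_le:
  assumes "x \<in> fine_adjoint P s" "0 < s"
  shows "finite {a. int_vec a \<and> a \<noteq> 0 \<and> slack x a \<le> R}"
proof -
  obtain r where r: "0 < r" "\<And>a. r * norm a \<le> slack x a" using slack_coercive[OF assms] by blast
  have "norm a \<le> R / r" if "slack x a \<le> R" for a
    using r(1) r(2)[of a] that by (simp add: field_simps)
  then show ?thesis by (intro finite_subset[OF _ finite_int_vec_bounded[of "R / r"]]) auto
qed

text \<open>Otherwise some direction v has positive inner product with all active vectors. A short
  move of x along v then raises every slack above s by a uniform amount, against maximality.\<close>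

lemma zero_in_hull_active:
  assumes x: "x \<in> fine_adjoint P s" and s: "0 < s"
    and max: "\<And>s'. 0 < s' \<Longrightarrow> fine_adjoint P s' \<noteq> {} \<Longrightarrow> s' \<le> s"
  shows "0 \<in> convex hull (active x s)"
proof (rule ccontr)
  assume no: "0 \<notin> convex hull (active x s)"
  have "finite (active x s)"
    by (rule finite_subset[OF _ finite_slack_le[OF x s, of s]]) (auto simp: active_def)
  then have "closed (convex hull (active x s))"
    by (intro compact_imp_closed finite_imp_compact_convex_hull)
  then obtain v c where "v \<bullet> 0 < c" "\<forall>a \<in> convex hull (active x s). c < v \<bullet> a"
    using separating_hyperplane_closed_point[OF convex_convex_hull _ no] by blast
  then have v: "0 < a \<bullet> v" if "a \<in> active x s" for a
    using that hull_inc[of a "active x s" convex] by (fastforce simp: inner_commute)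
  obtain r where r: "0 < r" "\<And>a. r * norm a \<le> slack x a" using slack_coercive[OF x s] by blast
  \<comment> \<open>Only these finitely many vectors need a limit argument. Beyond 2 s + 2 it
    suffices that the move keeps half of the slack, which is more than s + 1.\<close>
  define B where "B = {a. int_vec a \<and> a \<noteq> 0 \<and> slack x a \<le> 2 * s + 2}"
  have finB: "finite B" unfolding B_def by (rule finite_slack_le[OF x s])
  have shift: "slack (x + \<epsilon> *\<^sub>R v) a = slack x a + \<epsilon> * (a \<bullet> v)" for \<epsilon> a
    by (simp add: slack_def inner_add_right)
  have "eventually (\<lambda>\<epsilon>. s < slack (x + \<epsilon> *\<^sub>R v) a) (at_right 0)" if a: "a \<in> B" for a
  proof (cases "a \<in> active x s")
    case True
    then have "s < slack (x + \<epsilon> *\<^sub>R v) a" if "0 < \<epsilon>" for \<epsilon>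
      using v[OF True] that by (simp add: shift active_def)
    then show ?thesis
      by (intro eventually_mono[OF eventually_at_right_less]) auto
  next
    case False
    then have "s < slack x a"
      using a x by (auto simp: B_def active_def fine_adjoint_iff order_less_le)
    moreover have "((\<lambda>\<epsilon>. slack (x + \<epsilon> *\<^sub>R v) a) \<longlongrightarrow> slack x a + 0 * (a \<bullet> v)) (at_right 0)"
      unfolding shift by (intro tendsto_intros)
    ultimately show ?thesis by (intro order_tendstoD(1)) auto
  qed
  then have "eventually (\<lambda>\<epsilon>. \<forall>a\<in>B. s < slack (x + \<epsilon> *\<^sub>R v) a) (at_right 0)"
    using finB by (simp add: eventually_ball_finite)
  \<comment> \<open>This range of \<epsilon> changes the slack of a by at most r/2 times the norm of
    a, hence by at most half of it.\<close>
  moreover have "eventually (\<lambda>\<epsilon>. \<epsilon> \<in> {0<..<r / (2 * (norm v + 1))}) (at_right 0)"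
    using r(1) by (intro eventually_at_right_real) (simp add: add_nonneg_pos)
  ultimately have "eventually (\<lambda>\<epsilon>. (\<forall>a\<in>B. s < slack (x + \<epsilon> *\<^sub>R v) a)
      \<and> \<epsilon> \<in> {0<..<r / (2 * (norm v + 1))}) (at_right 0)"
    by (rule eventually_conj)
  then obtain \<epsilon> where \<epsilon>: "\<And>a. a \<in> B \<Longrightarrow> s < slack (x + \<epsilon> *\<^sub>R v) a" "0 < \<epsilon>" "\<epsilon> < r / (2 * (norm v + 1))"
    using eventually_happens'[OF trivial_limit_at_right_real] by fastforce
  have small: "\<epsilon> * norm v \<le> r / 2"
  proof -
    have "\<epsilon> * (2 * (norm v + 1)) < r"
      using \<epsilon>(3) by (simp add: pos_less_divide_eq add_nonneg_pos)
    then show ?thesis using \<epsilon>(2) by (simp add: algebra_simps)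
  qed
  define y where "y = x + \<epsilon> *\<^sub>R v"
  \<comment> \<open>The inserted 1 serves the vectors outside B and makes the minimum meaningful for
    empty B.\<close>
  define \<delta> where "\<delta> = Min (insert 1 ((\<lambda>a. slack y a - s) ` B))"
  have \<delta>: "0 < \<delta>" "\<delta> \<le> 1" "\<And>a. a \<in> B \<Longrightarrow> \<delta> \<le> slack y a - s"
    using finB \<epsilon>(1) by (auto simp: \<delta>_def y_def)
  have "s + \<delta> \<le> slack y a" if a: "int_vec a" "a \<noteq> 0" for a
  proof (cases "a \<in> B")
    case True
    then show ?thesis using \<delta>(3)[of a] by simp
  next
    case False
    then have big: "2 * s + 2 < slack x a" using a by (simp add: B_def)
    have "\<bar>\<epsilon> * (a \<bullet> v)\<bar> \<le> \<epsilon> * (norm a * norm v)"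
      using \<epsilon>(2) Cauchy_Schwarz_ineq2[of a v] by (simp add: abs_mult)
    also have "\<dots> \<le> r / 2 * norm a"
      using mult_right_mono[OF small norm_ge_zero[of a]] by (simp add: algebra_simps)
    also have "\<dots> \<le> slack x a / 2" using r(2)[of a] by simp
    finally have "slack x a / 2 \<le> slack y a" by (simp add: y_def shift abs_le_iff)
    then show ?thesis using big \<delta>(2) by simp
  qed
  then have "y \<in> fine_adjoint P (s + \<delta>)" by (simp add: fine_adjoint_iff)
  then have "s + \<delta> \<le> s" using max[of "s + \<delta>"] s \<delta>(1) by auto
  with \<delta>(1) show False by simp
qed

text \<open>The slack of a convex combination of active vectors is at most s by sublinearity; for a
  non-zero lattice vector it is also at least s.\<close>

lemma active_closed:
  assumes x: "x \<in> fine_adjoint P s" and s: "0 < s"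
    and b: "int_vec b" "b \<noteq> 0" "b \<in> convex hull (active x s)"
  shows "b \<in> active x s"
proof -
  have fin: "finite (active x s)"
    by (rule finite_subset[OF _ finite_slack_le[OF x s, of s]]) (auto simp: active_def)
  obtain u where u: "\<forall>t\<in>active x s. 0 \<le> u t" "sum u (active x s) = 1"
    "(\<Sum>t\<in>active x s. u t *\<^sub>R t) = b"
    using b(3) unfolding convex_hull_finite[OF fin] by blast
  have "slack x b \<le> (\<Sum>t\<in>active x s. u t * slack x t)"
    using slack_sum_le[of "active x s" u x] u by simp
  also have "\<dots> = (\<Sum>t\<in>active x s. u t * s)" by (intro sum.cong) (auto simp: active_def)
  also have "\<dots> = s" by (simp add: u(2) flip: sum_distrib_right)
  finally show ?thesis using b x by (force simp: active_def fine_adjoint_iff)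
qed

end

text \<open>Let b have coordinates frac (k u_t). Since the point with coordinates k u_t is 0, b is
  minus an integral combination of the vertices, so a lattice point of the simplex. If b = 0,
  uniqueness gives frac (k u_t) = u_t, and (k - 1) u_t is an integer.\<close>

lemma terminal_weights_simplex:
  fixes T :: "(real^3) set"
  assumes T: "\<not> affine_dependent T" and int_T: "\<And>t. t \<in> T \<Longrightarrow> int_vec t"
    and empty: "\<And>b. int_vec b \<Longrightarrow> b \<noteq> 0 \<Longrightarrow> b \<in> convex hull T \<Longrightarrow> b \<in> T"
    and u: "\<And>t. t \<in> T \<Longrightarrow> 0 < u t" "sum u T = 1" "(\<Sum>t\<in>T. u t *\<^sub>R t) = 0"
  shows "terminal_weights T u"
proof
  show fin: "finite T" using T by (rule aff_independent_finite)
  show "0 < u t" if "t \<in> T" for t using u(1) that .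
  show "sum u T = 1" by (rule u(2))
  fix k :: int and t
  assume sum: "(\<Sum>t\<in>T. frac (of_int k * u t)) = 1" and t: "t \<in> T"
  define b where "b = (\<Sum>t\<in>T. frac (of_int k * u t) *\<^sub>R t)"
  have "b = of_int k *\<^sub>R (\<Sum>t\<in>T. u t *\<^sub>R t) - (\<Sum>t\<in>T. of_int \<lfloor>of_int k * u t\<rfloor> *\<^sub>R t)"
    by (simp add: b_def frac_def scaleR_left_diff_distrib sum_subtractf scaleR_sum_right)
  then have "b = - (\<Sum>t\<in>T. of_int \<lfloor>of_int k * u t\<rfloor> *\<^sub>R t)" by (simp add: u(3))
  then have int_b: "int_vec b" using int_vec_sum int_T int_vec_uminus by metis
  have hull: "b \<in> convex hull T"
    using sum unfolding convex_hull_finite[OF fin] b_def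
    by (intro CollectI exI[of _ "\<lambda>t. frac (of_int k * u t)"]) auto
  show "of_int (k - 1) * u t \<in> \<int>"
  proof (cases "b = 0")
    case True
    then have "frac (of_int k * u t) = u t"
      using barycentric_unique[OF T _ _ t, of "\<lambda>t. frac (of_int k * u t)" u] sum u(2,3)
      by (simp add: b_def)
    then have "of_int (k - 1) * u t = of_int \<lfloor>of_int k * u t\<rfloor>"
      by (simp add: frac_def algebra_simps)
    then show ?thesis by simp
  next
    case False
    \<comment> \<open>If b were a vertex, its own coordinate would be 1, which no fractional part
      attains.\<close>
    then have b: "b \<in> T" using empty int_b hull by blast
    have "(\<Sum>t\<in>T. (if t = b then 1 else 0) *\<^sub>R t) = b"
      using b fin by (simp add: if_distrib[of "\<lambda>c. c *\<^sub>R _"] sum.delta cong: if_cong)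
    then have "frac (of_int k * u b) = (if b = b then 1 else 0)"
      using b fin sum
      by (intro barycentric_unique[OF T _ _ b, of "\<lambda>t. frac (of_int k * u t)"]) (simp_all add: b_def)
    then show ?thesis using frac_lt_1[of "of_int k * u b"] by simp
  qed
qed

context lattice_polytope
begin

text \<open>Averaging the equal slacks of the vertices with weights u eliminates x, as the vertices
  average to 0. This leaves s as an integral combination of the u_t.\<close>

lemma maximal_adjoint_rational:
  assumes x: "x \<in> fine_adjoint P s" and s: "0 < s"
    and max: "\<And>s'. 0 < s' \<Longrightarrow> fine_adjoint P s' \<noteq> {} \<Longrightarrow> s' \<le> s"
  obtains q where "q \<in> {2,3,4,5,7,11,13,17,19::nat}" "real q * s \<in> \<int>"
proof -
  have fin: "finite (active x s)"
    by (rule finite_subset[OF _ finite_slack_le[OF x s, of s]]) (auto simp: active_def)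
  obtain T where T: "T \<subseteq> active x s" "\<not> affine_dependent T" "0 \<in> convex hull T"
    "\<And>t. t \<in> T \<Longrightarrow> 0 \<notin> convex hull (T - {t})"
    "\<And>b. int_vec b \<Longrightarrow> b \<noteq> 0 \<Longrightarrow> b \<in> convex hull T \<Longrightarrow> b \<in> T"
    using obtain_empty_simplex[OF fin zero_in_hull_active[OF x s max] active_closed[OF x s]] by blast
  have finT: "finite T" using T(2) by (rule aff_independent_finite)
  have act: "int_vec t" "t \<noteq> 0" "slack x t = s" if "t \<in> T" for t
    using that T(1) by (auto simp: active_def)
  obtain u where u: "\<And>t. t \<in> T \<Longrightarrow> 0 < u t" "sum u T = 1" "(\<Sum>t\<in>T. u t *\<^sub>R t) = 0"
    using obtain_positive_coefficients[OF finT T(3,4)] by blast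
  interpret terminal_weights T u
    using T(2) act(1) T(5) u by (rule terminal_weights_simplex)
  have "card T \<noteq> 0" using u(2) finT by auto
  \<comment> \<open>A single point with 0 in its hull would be 0 itself, which is not
    active.\<close>
  moreover have "card T \<noteq> 1"
  proof
    assume "card T = 1"
    then obtain t where "T = {t}" by (auto simp: card_1_singleton_iff)
    then show False using T(3) act(2)[of t] by simp
  qed
  ultimately have "2 \<le> card T" by linarith
  moreover have "card T \<le> 4"
    using aff_dim_affine_independent[OF T(2)] aff_dim_le_DIM[of T] by simp
  ultimately obtain q where q: "q \<in> {2,3,4,5,7,11,13,17,19::nat}" "period (int q)"
    using period_cases by blast
  have "s = (\<Sum>t\<in>T. u t * slack x t)"
    using act(3) u(2) by (simp flip: sum_distrib_right)
  also have "\<dots> = (\<Sum>t\<in>T. u t *\<^sub>R t) \<bullet> x - (\<Sum>t\<in>T. u t * hP P t)"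
    by (simp add: slack_def inner_sum_left right_diff_distrib sum_subtractf)
  finally have "real q * s = - (\<Sum>t\<in>T. (of_int (int q) * u t) * hP P t)"
    by (simp add: u(3) sum_distrib_left mult.assoc)
  moreover have "(\<Sum>t\<in>T. (of_int (int q) * u t) * hP P t) \<in> \<int>"
    using q(2) act(1) hP_Ints by (intro Ints_sum, intro Ints_mult[of "_ * _"]) (auto simp: period_def)
  ultimately have "real q * s \<in> \<int>" by simp
  with q(1) that show ?thesis by blast
qed

lemma fine_codegree_eq:
  assumes "0 < s" "x \<in> fine_adjoint P s"
    "\<And>s'. 0 < s' \<Longrightarrow> fine_adjoint P s' \<noteq> {} \<Longrightarrow> s' \<le> s"
  shows "fine_codegree P = inverse s"
  unfolding fine_codegree_def using assms by (subst cSup_eq_maximum[of s]) auto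

lemma fine_codegree_rational:
  obtains q n where "q \<in> {2,3,4,5,7,11,13,17,19::nat}" "0 < n" "fine_codegree P = real q / real n"
proof -
  obtain x s where s: "0 < s" "x \<in> fine_adjoint P s"
    "\<And>s'. 0 < s' \<Longrightarrow> fine_adjoint P s' \<noteq> {} \<Longrightarrow> s' \<le> s"
    by (rule maximal_adjoint) (rule that)
  obtain q where q: "q \<in> {2,3,4,5,7,11,13,17,19::nat}" "real q * s \<in> \<int>"
    using maximal_adjoint_rational[OF s(2,1,3)] by blast
  then have "0 < q" by auto
  obtain i where i: "real q * s = of_int i" using q(2) by (rule Ints_cases)
  have "0 < real q * s" using s(1) \<open>0 < q\<close> by simp
  then have "0 < i" using i by simp
  have "s = real_of_int i / real q" using i \<open>0 < q\<close> by (simp add: field_simps)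
  then have "fine_codegree P = real q / real (nat i)"
    using fine_codegree_eq[OF s] \<open>0 < i\<close> by simp
  with q(1) \<open>0 < i\<close> that[of q "nat i"] show ?thesis by simp
qed

end

section \<open>The spectrum\<close>

lemma lattice_polytope3_iff: "lattice_polytope3 P \<longleftrightarrow> (\<exists>V. lattice_polytope V P)"
  by (auto simp: lattice_polytope3_def lattice_polytope_def)

section \<open>Behaviour under dilation\<close>

lemma hP_scaleR:
  assumes "lattice_polytope3 P" "0 \<le> c"
  shows "hP ((\<lambda>x. c *\<^sub>R x) ` P) a = c * hP P a"
proof -
  obtain V where "lattice_polytope V P" using assms(1) lattice_polytope3_iff by blast
  then interpret lattice_polytope V P .
  obtain v where v: "v \<in> V" "hP P a = a \<bullet> v" "\<And>x. x \<in> P \<Longrightarrow> a \<bullet> v \<le> a \<bullet> x"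
    using hP_attained[of a] by blast
  show ?thesis
    unfolding hP_def[of "_ ` P"] v(2)
  proof (rule cInf_eq_minimum)
    show "c * (a \<bullet> v) \<in> (\<lambda>x. a \<bullet> x) ` (\<lambda>x. c *\<^sub>R x) ` P"
      unfolding image_image using v(1) V_subset_P by (intro image_eqI[where x=v]) auto
  qed (use v(3) assms(2) in \<open>auto simp: mult_left_mono\<close>)
qed

lemma fine_adjoint_scaleR:
  assumes "lattice_polytope3 P" "0 < c"
  shows "c *\<^sub>R x \<in> fine_adjoint ((\<lambda>x. c *\<^sub>R x) ` P) (c * s) \<longleftrightarrow> x \<in> fine_adjoint P s"
proof -
  have "c * hP P a + c * s \<le> a \<bullet> (c *\<^sub>R x) \<longleftrightarrow> hP P a + s \<le> a \<bullet> x" for a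
    using assms(2) by (simp flip: distrib_left)
  then show ?thesis
    using assms by (simp add: fine_adjoint_def hP_scaleR)
qed

lemma lattice_polytope3_dilate:
  assumes "lattice_polytope3 P" "0 < (k::nat)"
  shows "lattice_polytope3 ((\<lambda>x. real k *\<^sub>R x) ` P)"
proof -
  obtain V where V: "finite V" "V \<noteq> {}" "\<forall>v\<in>V. int_vec v" "P = convex hull V" "aff_dim P = 3"
    using assms(1) by (auto simp: lattice_polytope3_def)
  have "aff_dim ((\<lambda>x. real k *\<^sub>R x) ` P) = 3"
    using assms(2) V(5) by (subst aff_dim_injective_linear_image) (auto intro: linear_scaleR inj_onI)
  moreover have "\<forall>v\<in>(\<lambda>x. real k *\<^sub>R x) ` V. int_vec v"
    using V(3) by (auto simp: int_vec_def intro!: Ints_mult)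
  ultimately show ?thesis
    unfolding lattice_polytope3_def
    using V by (intro conjI exI[of _ "(\<lambda>x. real k *\<^sub>R x) ` V"]) (auto simp: convex_hull_scaling)
qed

lemma fine_codegree_dilate:
  assumes P: "lattice_polytope3 P" and k: "0 < (k::nat)"
  shows "fine_codegree ((\<lambda>x. real k *\<^sub>R x) ` P) = fine_codegree P / real k"
proof -
  let ?Q = "(\<lambda>x. real k *\<^sub>R x) ` P"
  obtain V W where VW: "lattice_polytope V P" "lattice_polytope W ?Q"
    using P lattice_polytope3_dilate[OF P k] lattice_polytope3_iff by blast
  obtain x s where s: "0 < s" "x \<in> fine_adjoint P s"
    "\<And>s'. 0 < s' \<Longrightarrow> fine_adjoint P s' \<noteq> {} \<Longrightarrow> s' \<le> s"
    by (rule lattice_polytope.maximal_adjoint[OF VW(1)]) (rule that)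
  have "fine_codegree ?Q = inverse (real k * s)"
  proof (rule lattice_polytope.fine_codegree_eq[OF VW(2)])
    show "0 < real k * s" using k s(1) by simp
    show "real k *\<^sub>R x \<in> fine_adjoint ?Q (real k * s)"
      using fine_adjoint_scaleR[OF P] k s(2) by simp
    \<comment> \<open>Every admissible level of the dilate scales back to one of P.\<close>
    fix s' assume s': "0 < s'" "fine_adjoint ?Q s' \<noteq> {}"
    then obtain y where "y \<in> fine_adjoint ?Q s'" by blast
    then have "real k *\<^sub>R ((1 / real k) *\<^sub>R y) \<in> fine_adjoint ?Q (real k * (s' / real k))"
      using k by simp
    then have "(1 / real k) *\<^sub>R y \<in> fine_adjoint P (s' / real k)"
      using fine_adjoint_scaleR[OF P] k by (metis of_nat_0_less_iff)
    then have "s' / real k \<le> s" using s(3)[of "s' / real k"] s'(1) k by auto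
    then show "s' \<le> real k * s" using k by (simp add: field_simps)
  qed
  also have "\<dots> = fine_codegree P / real k"
    using lattice_polytope.fine_codegree_eq[OF VW(1) s] by (simp add: divide_inverse)
  finally show ?thesis .
qed

lemma fine_spectrum3_divide:
  "\<mu> \<in> fine_spectrum3 \<Longrightarrow> 0 < (k::nat) \<Longrightarrow> \<mu> / real k \<in> fine_spectrum3"
proof -
  assume "\<mu> \<in> fine_spectrum3" and k: "0 < k"
  then obtain P where P: "\<mu> = fine_codegree P" "lattice_polytope3 P"
    by (auto simp: fine_spectrum3_def)
  have "\<mu> / real k = fine_codegree ((\<lambda>x. real k *\<^sub>R x) ` P)"
    using fine_codegree_dilate[OF P(2) k] P(1) by simp
  with lattice_polytope3_dilate[OF P(2) k] show ?thesis
    unfolding fine_spectrum3_def by blast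
qed

lemma fine_spectrum3_cases:
  assumes "\<mu> \<in> fine_spectrum3"
  obtains q n where "q \<in> {2,3,4,5,7,11,13,17,19::nat}" "0 < n" "\<mu> = real q / real n"
proof -
  obtain V P where "\<mu> = fine_codegree P" "lattice_polytope V P"
    using assms by (auto simp: fine_spectrum3_def lattice_polytope3_iff)
  then show ?thesis using lattice_polytope.fine_codegree_rational that by metis
qed

text \<open>The witness is the standard simplex.\<close>

lemma fine_spectrum3_nonempty: "fine_spectrum3 \<noteq> {}"
proof -
  define V :: "(real^3) set" where "V = insert 0 Basis"
  have "0 \<in> affine hull V" by (simp add: V_def hull_inc)
  then have "aff_dim V = int (dim V)" by (rule aff_dim_zero)
  also have "dim V = dim (UNIV :: (real^3) set)"
    using dim_span[of V] by (simp add: V_def span_insert_0)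
  finally have "aff_dim V = 3" by simp
  moreover have "\<forall>v\<in>V. int_vec v"
    by (auto simp: V_def Basis_vec_def int_vec_axis) (simp add: int_vec_def)
  ultimately have "lattice_polytope3 (convex hull V)"
    unfolding lattice_polytope3_def
    by (intro conjI exI[of _ V]) (auto simp: V_def aff_dim_convex_hull)
  then show ?thesis by (auto simp: fine_spectrum3_def)
qed

theorem mainTheorem8:
  shows "\<exists>S :: nat \<Rightarrow> nat set.
    (\<forall>q\<in>{2,3,4,5,7,11,13,17,19}. S q \<noteq> {} \<and> S q \<subseteq> {0<..}) \<and>
    fine_spectrum3 =
      {real q / (real k * real l) | q k l.
         q \<in> {2,3,4,5,7,11,13,17,19} \<and> l \<in> S q \<and> k > 0}"
proof -
  \<comment> \<open>The largest possible choice; closure of the spectrum under division by k will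
    supply the inclusion from right to left.\<close>
  define S where "S q = {l::nat. 0 < l \<and> real q / real l \<in> fine_spectrum3}" for q :: nat
  have "S q \<noteq> {}" if "q \<in> {2,3,4,5,7,11,13,17,19}" for q
  proof -
    obtain \<mu> where \<mu>: "\<mu> \<in> fine_spectrum3" using fine_spectrum3_nonempty by blast
    obtain q' n where n: "q' \<in> {2,3,4,5,7,11,13,17,19::nat}" "0 < n" "\<mu> = real q' / real n"
      using fine_spectrum3_cases[OF \<mu>] by blast
    have q: "0 < q" "0 < q'" using n(1) that by auto
    \<comment> \<open>Dividing any value q'/n by q' gives 1/n, which can be rewritten with any
      numerator q. Hence no \<open>S q\<close> is empty.\<close>
    have "real q / real (q * n) = \<mu> / real q'"
      using q n by simp
    then have "q * n \<in> S q"
      using fine_spectrum3_divide[OF \<mu> q(2)] q(1) n(2) by (simp add: S_def)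
    then show ?thesis by blast
  qed
  moreover have "fine_spectrum3 = {real q / (real k * real l) | q k l.
         q \<in> {2,3,4,5,7,11,13,17,19} \<and> l \<in> S q \<and> k > 0}" (is "_ = ?R")
  proof (intro equalityI subsetI)
    fix \<mu> assume \<mu>: "\<mu> \<in> fine_spectrum3"
    obtain q n where n: "q \<in> {2,3,4,5,7,11,13,17,19::nat}" "0 < n" "\<mu> = real q / real n"
      using fine_spectrum3_cases[OF \<mu>] by blast
    then have "n \<in> S q" using \<mu> by (simp add: S_def)
    moreover have "\<mu> = real q / (real 1 * real n)" using n(3) by simp
    ultimately show "\<mu> \<in> ?R" using n(1) zero_less_one by blast
  next
    fix \<mu> assume "\<mu> \<in> ?R"
    then obtain q k l where "\<mu> = real q / (real k * real l)" "l \<in> S q" "0 < k" by blast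
    then show "\<mu> \<in> fine_spectrum3"
      using fine_spectrum3_divide[of "real q / real l" k] by (simp add: S_def mult.commute)
  qed
  ultimately show ?thesis by (intro exI[of _ S]) (auto simp: S_def)
qed

end
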